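(* Suppose $\kappa$ is a measurable cardinal which is a limit of measurable cardinals, $\delta \leq \kappa$, and $f : \delta \to 2$. Then there is a transitive set $M \subseteq V_\kappa$ with $|M| = \kappa$ and an elementary embedding $j : M \to V_\kappa$ such that the set of cardinals of $M$ that are greater than $\operatorname{crit}(j)$ and fixed by $j$ has ordertype $\delta$, and for every $\alpha < \delta$, the $\alpha$-th such fixed point is regular if and only if $f(\alpha) = 1$.
   Context: $\operatorname{crit}(j)$ denotes the least ordinal moved by $j$. The fixed points are enumerated in increasing order starting from the $0$-th. *)

theory Defs
  imports Main "HOL-Library.Equipollence" "HOL-Library.FuncSet" "HOL-Library.Countable_Set"
begin

(* The background theory ZFC, as a class of types whose elements are the sets. Separation and
   replacement range over all HOL predicates and functions, so a HOL function restricted to a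
   set is (coded by) a set; choice is inherited from HOL. *)
class zfc_universe =
  fixes elts :: "'a \<Rightarrow> 'a set"
  assumes extensionality: "elts x = elts y \<Longrightarrow> x = y"
    and foundation: "wf {(x, y). x \<in> elts y}"
    and pairing: "\<exists>z. elts z = {x, y}"
    and union: "\<exists>y. elts y = \<Union> (elts ` elts x)"
    and power_set: "\<exists>y. elts y = {z. elts z \<subseteq> elts x}"
    and separation: "Y \<subseteq> elts x \<Longrightarrow> \<exists>y. elts y = Y"
    and replacement: "\<exists>y. elts y = F ` elts x"
    and infinity: "\<exists>x. (\<exists>e\<in>elts x. elts e = {}) \<and>
                       (\<forall>y\<in>elts x. \<exists>z\<in>elts x. elts z = insert y (elts y))"

(* Meaningful only if X is not a proper class. *)
definition set_of :: "'a::zfc_universe set \<Rightarrow> 'a" where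
  "set_of X = (THE x. elts x = X)"

lemma elts_set_of: "\<exists>x. elts x = X \<Longrightarrow> elts (set_of X) = X"
  unfolding set_of_def by (rule theI') (metis extensionality)

definition Transset :: "'a::zfc_universe \<Rightarrow> bool" where
  "Transset x \<longleftrightarrow> (\<forall>y\<in>elts x. elts y \<subseteq> elts x)"

(* Von Neumann ordinals; by foundation this needs no well-ordering clause. The order on
   ordinals is membership. *)
definition Ord :: "'a::zfc_universe \<Rightarrow> bool" where
  "Ord \<alpha> \<longleftrightarrow> Transset \<alpha> \<and> (\<forall>\<beta>\<in>elts \<alpha>. Transset \<beta>)"

function Vset :: "'a::zfc_universe \<Rightarrow> 'a" where
  "Vset \<alpha> = set_of (\<Union>\<beta>\<in>elts \<alpha>. {x. elts x \<subseteq> elts (Vset \<beta>)})"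
  by auto
termination
  by (relation "{(x, y). x \<in> elts y}") (auto simp: foundation)

declare Vset.simps [simp del]

lemma elts_Vset: "elts (Vset \<alpha>) = (\<Union>\<beta>\<in>elts \<alpha>. {x. elts x \<subseteq> elts (Vset \<beta>)})"
proof -
  define P where "P \<beta> = set_of {x. elts x \<subseteq> elts (Vset \<beta>)}" for \<beta> :: 'a
  have P: "elts (P \<beta>) = {x. elts x \<subseteq> elts (Vset \<beta>)}" for \<beta>
    unfolding P_def by (rule elts_set_of[OF power_set])
  obtain y where y: "elts y = P ` elts \<alpha>" using replacement by blast
  obtain z where "elts z = \<Union> (elts ` elts y)" using union by blast
  then have "\<exists>z. elts z = (\<Union>\<beta>\<in>elts \<alpha>. {x. elts x \<subseteq> elts (Vset \<beta>)})"
    using y P by auto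
  then show ?thesis by (subst Vset.simps) (rule elts_set_of)
qed

definition Cardinal :: "'a::zfc_universe \<Rightarrow> bool" where
  "Cardinal \<kappa> \<longleftrightarrow> Ord \<kappa> \<and> (\<forall>\<alpha>\<in>elts \<kappa>. \<not> elts \<alpha> \<approx> elts \<kappa>)"

definition regular_cardinal :: "'a::zfc_universe \<Rightarrow> bool" where
  "regular_cardinal \<kappa> \<longleftrightarrow> Cardinal \<kappa> \<and> infinite (elts \<kappa>) \<and>
     (\<forall>\<alpha>\<in>elts \<kappa>. \<forall>g\<in>elts \<alpha> \<rightarrow> elts \<kappa>. \<exists>\<beta>\<in>elts \<kappa>. \<forall>\<xi>\<in>elts \<alpha>. g \<xi> \<in> elts \<beta>)"

definition ultrafilter_on :: "'a set \<Rightarrow> 'a set set \<Rightarrow> bool" where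
  "ultrafilter_on S U \<longleftrightarrow> U \<subseteq> Pow S \<and> S \<in> U \<and> {} \<notin> U \<and>
     (\<forall>X\<in>U. \<forall>Y. X \<subseteq> Y \<and> Y \<subseteq> S \<longrightarrow> Y \<in> U) \<and>
     (\<forall>X\<in>U. \<forall>Y\<in>U. X \<inter> Y \<in> U) \<and>
     (\<forall>X. X \<subseteq> S \<longrightarrow> X \<in> U \<or> S - X \<in> U)"

definition measurable_cardinal :: "'a::zfc_universe \<Rightarrow> bool" where
  "measurable_cardinal \<kappa> \<longleftrightarrow> Cardinal \<kappa> \<and> uncountable (elts \<kappa>) \<and>
     (\<exists>U. ultrafilter_on (elts \<kappa>) U \<and>
          (\<forall>\<xi>\<in>elts \<kappa>. {\<xi>} \<notin> U) \<and>
          (\<forall>F. F \<subseteq> U \<and> F \<noteq> {} \<and> F \<prec> elts \<kappa> \<longrightarrow> \<Inter> F \<in> U))"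

definition limit_of_measurables :: "'a::zfc_universe \<Rightarrow> bool" where
  "limit_of_measurables \<kappa> \<longleftrightarrow>
     (\<forall>\<alpha>\<in>elts \<kappa>. \<exists>\<mu>\<in>elts \<kappa>. \<alpha> \<in> elts \<mu> \<and> measurable_cardinal \<mu>)"

(* First-order formulas of the language of set theory, with variables named by numbers. *)
datatype fm = Mem nat nat | Eq nat nat | Neg fm | Conj fm fm | All nat fm

primrec sat :: "'a::zfc_universe \<Rightarrow> (nat \<Rightarrow> 'a) \<Rightarrow> fm \<Rightarrow> bool" where
  "sat M s (Mem m n) \<longleftrightarrow> s m \<in> elts (s n)"
| "sat M s (Eq m n) \<longleftrightarrow> s m = s n"
| "sat M s (Neg p) \<longleftrightarrow> \<not> sat M s p"
| "sat M s (Conj p q) \<longleftrightarrow> sat M s p \<and> sat M s q"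
| "sat M s (All n p) \<longleftrightarrow> (\<forall>x\<in>elts M. sat M (s(n := x)) p)"

(* M and N are understood to be nonempty. *)
definition elementary_embedding :: "('a::zfc_universe \<Rightarrow> 'a) \<Rightarrow> 'a \<Rightarrow> 'a \<Rightarrow> bool" where
  "elementary_embedding j M N \<longleftrightarrow> j \<in> elts M \<rightarrow> elts N \<and>
     (\<forall>p s. range s \<subseteq> elts M \<longrightarrow> (sat M s p \<longleftrightarrow> sat N (j \<circ> s) p))"

(* A relation rather than a function, so that asserting it includes the assertion that j
   moves some ordinal. *)
definition is_crit :: "'a::zfc_universe \<Rightarrow> ('a \<Rightarrow> 'a) \<Rightarrow> 'a \<Rightarrow> bool" where
  "is_crit M j \<gamma> \<longleftrightarrow> \<gamma> \<in> elts M \<and> Ord \<gamma> \<and> j \<gamma> \<noteq> \<gamma> \<and>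
     (\<forall>\<beta>\<in>elts M. Ord \<beta> \<and> j \<beta> \<noteq> \<beta> \<longrightarrow> \<gamma> = \<beta> \<or> \<gamma> \<in> elts \<beta>)"

definition opair :: "'a::zfc_universe \<Rightarrow> 'a \<Rightarrow> 'a" where
  "opair x y = set_of {set_of {x, x}, set_of {x, y}}"

definition is_bijection :: "'a::zfc_universe \<Rightarrow> 'a \<Rightarrow> 'a \<Rightarrow> bool" where
  "is_bijection b x y \<longleftrightarrow>
     (\<exists>g. bij_betw g (elts x) (elts y) \<and> elts b = (\<lambda>u. opair u (g u)) ` elts x)"

(* "x is a cardinal" as interpreted in the transitive set M: there is no bijection in M from a
   smaller ordinal. Being an ordinal and being a bijection are Delta_0, so only the quantifier
   over bijections has to be relativised to M. *)
definition cardinal_in :: "'a::zfc_universe \<Rightarrow> 'a \<Rightarrow> bool" where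
  "cardinal_in M x \<longleftrightarrow> x \<in> elts M \<and> Ord x \<and>
     \<not> (\<exists>\<beta>\<in>elts x. \<exists>b\<in>elts M. is_bijection b \<beta> x)"

definition fixed_cardinals :: "'a::zfc_universe \<Rightarrow> ('a \<Rightarrow> 'a) \<Rightarrow> 'a \<Rightarrow> 'a set" where
  "fixed_cardinals M j \<gamma> = {x. cardinal_in M x \<and> \<gamma> \<in> elts x \<and> j x = x}"

(* The set S of ordinals has order type \<delta>, and e is its (unique on \<delta>) increasing
   enumeration: e \<alpha> is the \<alpha>-th element of S, starting from the 0-th. *)
definition enumerates :: "('a::zfc_universe \<Rightarrow> 'a) \<Rightarrow> 'a \<Rightarrow> 'a set \<Rightarrow> bool" where
  "enumerates e \<delta> S \<longleftrightarrow> bij_betw e (elts \<delta>) S \<and>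
     (\<forall>\<alpha>\<in>elts \<delta>. \<forall>\<beta>\<in>elts \<delta>. \<alpha> \<in> elts \<beta> \<longrightarrow> e \<alpha> \<in> elts (e \<beta>))"

end

theory Submission
  imports Defs
begin

text \<open>
  Every elementary \<open>j : M \<rightarrow> V\<^sub>\<kappa>\<close> with \<open>M\<close> transitive is the inverse of the collapse of an elementary
  submodel \<open>Y\<close> of \<open>V\<^sub>\<kappa>\<close>, and a cardinal \<open>x \<in> Y\<close> is fixed by \<open>j\<close> iff \<open>|Y \<inter> x| = |x|\<close>. So one has to
  build a Skolem hull of size \<open>\<kappa>\<close> that is full exactly at prescribed cardinals.

  If \<open>\<mu> \<in> X\<close> is measurable and \<open>|X| < \<mu>\<close>, then adding to the hull \<open>X\<close> a point \<open>\<xi> < \<mu>\<close> that lies in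
  all relevant measure one sets produces nothing new below \<open>sup (X \<inter> \<mu>)\<close>; iterating gives end
  extensions of \<open>X \<inter> \<mu>\<close> of any size up to \<open>\<mu>\<close>. Start from a countable hull and use the measure on
  \<open>\<kappa>\<close> to jump above everything constructed so far. Filling up the next measurable \<open>\<mu>\<close> with \<open>\<mu>\<close>
  many points creates one new fixed cardinal, a regular one. Filling the \<open>(n + 1)\<close>-st of the next
  \<open>\<omega>\<close> measurables with as many points as the size of the \<open>n\<close>-th creates one new fixed cardinal, their
  singular limit. After \<open>\<delta>\<close> such blocks, add points with the measure on \<open>\<kappa>\<close> alone.
\<close>

section \<open>Ordinals, pairs and the cumulative hierarchy\<close>

lemma mem_induct [case_names step]:
  fixes a :: "'a::zfc_universe"
  assumes "\<And>x. (\<And>y. y \<in> elts x \<Longrightarrow> P y) \<Longrightarrow> P x"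
  shows "P a"
  by (rule wf_induct[OF foundation]) (use assms in auto)

lemma mem_minimal:
  fixes S :: "'a::zfc_universe set"
  assumes "S \<noteq> {}"
  obtains m where "m \<in> S" "\<And>y. y \<in> elts m \<Longrightarrow> y \<notin> S"
  using wf_eq_minimal[THEN iffD1, OF foundation] assms by (metis (mono_tags) case_prod_conv mem_Collect_eq ex_in_conv)

lemma mem_not_refl: "x \<notin> elts (x::'a::zfc_universe)"
  using wf_not_refl[OF foundation, of x] by simp

lemma mem_not_sym: "x \<in> elts y \<Longrightarrow> y \<notin> elts (x::'a::zfc_universe)"
  using wf_not_sym[OF foundation, of x y] by simp

lemma elts_set_of_image [simp]:
  fixes f :: "'a::zfc_universe \<Rightarrow> 'a"
  shows "elts (set_of (f ` elts x)) = f ` elts x"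
  by (rule elts_set_of[OF replacement])

lemma elts_set_of_subset: "Y \<subseteq> elts x \<Longrightarrow> elts (set_of Y) = Y"
  by (rule elts_set_of[OF separation])

lemma elts_set_of_image_subset:
  fixes f :: "'a::zfc_universe \<Rightarrow> 'a"
  shows "Y \<subseteq> elts x \<Longrightarrow> elts (set_of (f ` Y)) = f ` Y"
  by (metis elts_set_of_image elts_set_of_subset)

lemma elts_upair [simp]: "elts (set_of {x, y}) = {x, y::'a::zfc_universe}"
  by (rule elts_set_of[OF pairing])

lemma upair_inject: "set_of {x, y} = set_of {u, v} \<longleftrightarrow> {x, y} = {u, v::'a::zfc_universe}"
  by (metis elts_upair)

lemma opair_inject [simp]: "opair x y = opair u v \<longleftrightarrow> x = u \<and> y = (v::'a::zfc_universe)"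
  unfolding opair_def upair_inject by (metis (no_types, opaque_lifting) doubleton_eq_iff upair_inject)

definition pfst :: "'a::zfc_universe \<Rightarrow> 'a" where "pfst w = (THE x. \<exists>y. w = opair x y)"
definition psnd :: "'a::zfc_universe \<Rightarrow> 'a" where "psnd w = (THE y. \<exists>x. w = opair x y)"

lemma pfst_opair [simp]: "pfst (opair x y) = x" and psnd_opair [simp]: "psnd (opair x y) = y"
  by (auto simp: pfst_def psnd_def)

definition lam :: "'a::zfc_universe \<Rightarrow> ('a \<Rightarrow> 'a) \<Rightarrow> 'a" where
  "lam x g = set_of ((\<lambda>u. opair u (g u)) ` elts x)"

definition app :: "'a::zfc_universe \<Rightarrow> 'a \<Rightarrow> 'a" where
  "app b u = (THE v. opair u v \<in> elts b)"

lemma app_eq: "elts b = (\<lambda>u. opair u (g u)) ` elts x \<Longrightarrow> u \<in> elts x \<Longrightarrow> app b u = g u"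
  by (auto simp: app_def)

lemma app_lam [simp]: "u \<in> elts x \<Longrightarrow> app (lam x g) u = g u"
  by (rule app_eq[of _ _ x]) (simp_all add: lam_def)

lemma Ord_mem: "Ord a \<Longrightarrow> b \<in> elts a \<Longrightarrow> Ord b"
  unfolding Ord_def Transset_def by blast

lemma Ord_trans: "Ord a \<Longrightarrow> b \<in> elts a \<Longrightarrow> c \<in> elts b \<Longrightarrow> c \<in> elts a"
  unfolding Ord_def Transset_def by blast

lemma Ord_subset: "Ord a \<Longrightarrow> b \<in> elts a \<Longrightarrow> elts b \<subseteq> elts a"
  unfolding Ord_def Transset_def by blast

lemma OrdI: "(\<And>b. b \<in> elts a \<Longrightarrow> Ord b) \<Longrightarrow> (\<And>b c. b \<in> elts a \<Longrightarrow> c \<in> elts b \<Longrightarrow> c \<in> elts a) \<Longrightarrow> Ord a"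
  unfolding Ord_def Transset_def by blast

lemma Ord_linear:
  "Ord a \<Longrightarrow> Ord b \<Longrightarrow> a \<in> elts b \<or> a = b \<or> b \<in> elts (a::'a::zfc_universe)"
proof (induction a arbitrary: b rule: mem_induct)
  case (step a)
  note IHa = step.IH and a = step.prems(1)
  from step.prems(2) show ?case
  proof (induction b rule: mem_induct)
    case (step b)
    show ?case
    proof (rule ccontr)
      assume n: "\<not> ?thesis"
      have "elts a = elts b"
      proof (intro equalityI subsetI)
        fix x assume x: "x \<in> elts a"
        then have "x \<in> elts b \<or> x = b \<or> b \<in> elts x" using IHa a step.prems Ord_mem by blast
        then show "x \<in> elts b" using n x a Ord_trans by blast
      next
        fix x assume x: "x \<in> elts b"
        then have "a \<in> elts x \<or> a = x \<or> x \<in> elts a" using step Ord_mem by blast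
        then show "x \<in> elts a" using n x step.prems Ord_trans by blast
      qed
      then show False using n extensionality by blast
    qed
  qed
qed

lemma Ord_subset_iff:
  assumes "Ord a" "Ord b"
  shows "elts a \<subseteq> elts b \<longleftrightarrow> a = b \<or> a \<in> elts (b::'a::zfc_universe)"
  using Ord_linear[OF assms] Ord_subset assms mem_not_refl by blast

lemma Ord_not_mem_iff:
  assumes "Ord a" "Ord b"
  shows "a \<notin> elts b \<longleftrightarrow> elts b \<subseteq> elts (a::'a::zfc_universe)"
  using Ord_linear[OF assms] Ord_subset_iff[OF assms(2,1)] mem_not_refl mem_not_sym by blast

lemma Cardinal_Ord: "Cardinal k \<Longrightarrow> Ord k"
  by (simp add: Cardinal_def)

lemma Cardinal_lesspoll: "Cardinal k \<Longrightarrow> a \<in> elts k \<Longrightarrow> elts a \<prec> elts k"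
  by (metis Cardinal_def Ord_subset lesspoll_def subset_imp_lepoll)

lemma Vset_mono_mem: "Ord a \<Longrightarrow> b \<in> elts a \<Longrightarrow> elts (Vset b) \<subseteq> elts (Vset a)"
  unfolding elts_Vset[of a] elts_Vset[of b] using Ord_trans by blast

lemma Vset_elts_subset: "Ord a \<Longrightarrow> x \<in> elts (Vset a) \<Longrightarrow> elts x \<subseteq> elts (Vset a)"
proof -
  assume a: "Ord a" and "x \<in> elts (Vset a)"
  then obtain b where "b \<in> elts a" "elts x \<subseteq> elts (Vset b)" unfolding elts_Vset[of a] by blast
  then show ?thesis using Vset_mono_mem[OF a] by blast
qed

lemma Vset_trans: "Ord a \<Longrightarrow> x \<in> elts (Vset a) \<Longrightarrow> y \<in> elts x \<Longrightarrow> y \<in> elts (Vset a)"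
  using Vset_elts_subset by blast

lemma Vset_memI: "b \<in> elts a \<Longrightarrow> elts x \<subseteq> elts (Vset b) \<Longrightarrow> x \<in> elts (Vset a)"
  unfolding elts_Vset[of a] by blast

lemma Ord_subset_Vset: "Ord a \<Longrightarrow> elts a \<subseteq> elts (Vset a)"
proof (induction a rule: mem_induct)
  case (step a)
  show ?case
  proof
    fix x assume "x \<in> elts a"
    with step show "x \<in> elts (Vset a)" using Vset_memI Ord_mem by metis
  qed
qed

lemma Ord_in_Vset: "Ord a \<Longrightarrow> Ord x \<Longrightarrow> x \<in> elts (Vset a) \<Longrightarrow> x \<in> elts (a::'a::zfc_universe)"
proof (induction a arbitrary: x rule: mem_induct)
  case (step a)
  obtain b where b: "b \<in> elts a" "elts x \<subseteq> elts (Vset b)"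
    using step.prems unfolding elts_Vset[of a] by blast
  have "elts x \<subseteq> elts b" using b step.IH step.prems Ord_mem by blast
  then have "x = b \<or> x \<in> elts b" using Ord_subset_iff step.prems b Ord_mem by blast
  then show ?case using b step.prems Ord_trans by blast
qed

lemma upair_in_Vset:
  "b \<in> elts a \<Longrightarrow> x \<in> elts (Vset b) \<Longrightarrow> y \<in> elts (Vset b) \<Longrightarrow> set_of {x, y} \<in> elts (Vset a)"
  by (rule Vset_memI) auto

section \<open>Measurable cardinals\<close>

lemma lepoll_UN_infinite:
  assumes "infinite B" "I \<lesssim> B" "\<And>i. i \<in> I \<Longrightarrow> A i \<lesssim> B"
  shows "(\<Union>i\<in>I. A i) \<lesssim> B"
  using card_of_UNION_ordLeq_infinite[of B I A] assms
  by (simp add: lepoll_def card_of_ordLeq)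

lemma lepoll_Un_infinite:
  assumes "infinite B" "A \<lesssim> B" "C \<lesssim> B"
  shows "A \<union> C \<lesssim> B"
proof -
  have "(\<Union>b\<in>(UNIV::bool set). if b then A else C) \<lesssim> B"
    by (rule lepoll_UN_infinite[OF assms(1) finite_lepoll_infinite[OF assms(1)]]) (use assms in auto)
  moreover have "(\<Union>b\<in>(UNIV::bool set). if b then A else C) = A \<union> C" by (auto simp: UNIV_bool)
  ultimately show ?thesis by simp
qed

lemma lesspoll_or_lepoll: "A \<prec> B \<or> B \<lesssim> A"
  unfolding lesspoll_def lepoll_def eqpoll_def
  by (meson card_of_ordLeq card_of_ordIso ordIso_iff_ordLeq ordLeq_total card_of_Well_order)

lemma lepoll_not_lesspoll: "A \<lesssim> B \<Longrightarrow> \<not> B \<prec> A"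
  using lesspoll_trans1 by blast

definition complete_ultrafilter :: "'a::zfc_universe \<Rightarrow> 'a set set \<Rightarrow> bool" where
  "complete_ultrafilter \<mu> U \<longleftrightarrow> ultrafilter_on (elts \<mu>) U \<and> (\<forall>\<xi>\<in>elts \<mu>. {\<xi>} \<notin> U) \<and>
     (\<forall>F. F \<subseteq> U \<and> F \<noteq> {} \<and> F \<prec> elts \<mu> \<longrightarrow> \<Inter> F \<in> U)"

definition meas_uf :: "'a::zfc_universe \<Rightarrow> 'a set set" where
  "meas_uf \<mu> = (SOME U. complete_ultrafilter \<mu> U)"

locale measurable =
  fixes \<mu> :: "'a::zfc_universe"
  assumes meas: "measurable_cardinal \<mu>"
begin

abbreviation U where "U \<equiv> meas_uf \<mu>"

lemma Cardinal: "Cardinal \<mu>" and uncountable: "uncountable (elts \<mu>)"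
  using meas unfolding measurable_cardinal_def by auto

lemma Ord: "Ord \<mu>" using Cardinal Cardinal_Ord by blast

lemma infinite: "infinite (elts \<mu>)" using uncountable uncountable_infinite by blast

lemma cuf: "complete_ultrafilter \<mu> U"
proof -
  have "\<exists>U. complete_ultrafilter \<mu> U"
    using meas unfolding measurable_cardinal_def complete_ultrafilter_def by (elim conjE)
  then show ?thesis unfolding meas_uf_def by (rule someI_ex)
qed

lemma uf: "ultrafilter_on (elts \<mu>) U"
  using cuf by (simp add: complete_ultrafilter_def)

lemma U_subset: "A \<in> U \<Longrightarrow> A \<subseteq> elts \<mu>"
  using uf by (auto simp: ultrafilter_on_def)

lemma U_empty: "{} \<notin> U"
  using uf by (simp add: ultrafilter_on_def)

lemma U_top: "elts \<mu> \<in> U"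
  using uf by (simp add: ultrafilter_on_def)

lemma U_ultra: "A \<subseteq> elts \<mu> \<Longrightarrow> A \<in> U \<or> elts \<mu> - A \<in> U"
  using uf by (simp add: ultrafilter_on_def)

lemma U_Int: "A \<in> U \<Longrightarrow> B \<in> U \<Longrightarrow> A \<inter> B \<in> U"
  using uf by (simp add: ultrafilter_on_def)

lemma U_meet: "A \<in> U \<Longrightarrow> B \<in> U \<Longrightarrow> A \<inter> B \<noteq> {}"
  using U_Int U_empty by metis

lemma U_sing: "\<xi> \<in> elts \<mu> \<Longrightarrow> {\<xi>} \<notin> U"
  using cuf by (simp add: complete_ultrafilter_def)

lemma U_Inter: "F \<subseteq> U \<Longrightarrow> F \<noteq> {} \<Longrightarrow> F \<prec> elts \<mu> \<Longrightarrow> \<Inter> F \<in> U"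
  using cuf by (simp add: complete_ultrafilter_def)

lemma U_INT:
  assumes "I \<prec> elts \<mu>" "\<And>i. i \<in> I \<Longrightarrow> A i \<in> U"
  shows "{\<xi>\<in>elts \<mu>. \<forall>i\<in>I. \<xi> \<in> A i} \<in> U"
proof (cases "I = {}")
  case True
  then show ?thesis using U_top by simp
next
  case False
  then have "{\<xi>\<in>elts \<mu>. \<forall>i\<in>I. \<xi> \<in> A i} = \<Inter> (A ` I)" using assms(2) U_subset by blast
  moreover have "\<Inter> (A ` I) \<in> U"
    by (rule U_Inter) (use assms False lesspoll_trans1[OF image_lepoll] in auto)
  ultimately show ?thesis by simp
qed

lemma U_UN:
  assumes "I \<prec> elts \<mu>" "(\<Union>i\<in>I. A i) \<in> U"
  shows "\<exists>i\<in>I. A i \<in> U"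
proof (rule ccontr)
  assume n: "\<not> ?thesis"
  have "elts \<mu> - A i \<in> U" if "i \<in> I" for i
    using U_ultra[of "A i"] U_subset[OF assms(2)] n that by blast
  then have "{\<xi>\<in>elts \<mu>. \<forall>i\<in>I. \<xi> \<in> elts \<mu> - A i} \<in> U" by (rule U_INT[OF assms(1)])
  then have "{\<xi>\<in>elts \<mu>. \<forall>i\<in>I. \<xi> \<in> elts \<mu> - A i} \<inter> (\<Union>i\<in>I. A i) \<noteq> {}"
    using assms(2) by (rule U_meet)
  then show False by blast
qed

lemma small_not_in_U: "A \<prec> elts \<mu> \<Longrightarrow> A \<notin> U"
  using U_UN[of A "\<lambda>x. {x}"] U_sing U_subset by force

lemma lesspoll_UN:
  assumes "I \<prec> elts \<mu>" "\<And>i. i \<in> I \<Longrightarrow> A i \<prec> elts \<mu>"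
  shows "(\<Union>i\<in>I. A i) \<prec> elts \<mu>"
proof (rule ccontr)
  assume "\<not> ?thesis"
  then obtain g where g: "inj_on g (elts \<mu>)" "g ` elts \<mu> \<subseteq> (\<Union>i\<in>I. A i)"
    using lesspoll_or_lepoll lepoll_def by metis
  have "(\<Union>i\<in>I. {\<xi>\<in>elts \<mu>. g \<xi> \<in> A i}) = elts \<mu>" using g by blast
  then obtain i where i: "i \<in> I" "{\<xi>\<in>elts \<mu>. g \<xi> \<in> A i} \<in> U"
    using U_UN[OF assms(1), of "\<lambda>i. {\<xi>\<in>elts \<mu>. g \<xi> \<in> A i}"] U_top by auto
  have "{\<xi>\<in>elts \<mu>. g \<xi> \<in> A i} \<lesssim> A i"
    unfolding lepoll_def by (rule exI[of _ g]) (use g in \<open>auto simp: inj_on_def\<close>)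
  then show False using i assms(2) small_not_in_U lesspoll_trans1 by blast
qed

lemma lesspoll_insert: "A \<prec> elts \<mu> \<Longrightarrow> insert x A \<prec> elts \<mu>"
  by (metis finite_insert infinite finite_lesspoll_infinite infinite_insert_lepoll lesspoll_trans1)

lemma mem_lesspoll: "\<alpha> \<in> elts \<mu> \<Longrightarrow> elts \<alpha> \<prec> elts \<mu>"
  using Cardinal Cardinal_lesspoll by blast

lemma bounded:
  assumes "Z \<subseteq> elts \<mu>" "Z \<prec> elts \<mu>"
  obtains \<eta> where "\<eta> \<in> elts \<mu>" "Z \<subseteq> elts \<eta>"
proof -
  have "(\<Union>z\<in>Z. insert z (elts z)) \<prec> elts \<mu>"
    by (rule lesspoll_UN[OF assms(2)]) (meson assms(1) lesspoll_insert mem_lesspoll subsetD)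
  then obtain \<eta> where \<eta>: "\<eta> \<in> elts \<mu>" "\<eta> \<notin> (\<Union>z\<in>Z. insert z (elts z))"
    by (metis lepoll_not_lesspoll subset_imp_lepoll subsetI)
  then have "Z \<subseteq> elts \<eta>"
    using assms Ord_linear Ord Ord_mem by blast
  with \<eta> that show ?thesis by blast
qed

lemma regular: "regular_cardinal \<mu>"
  unfolding regular_cardinal_def
proof (intro conjI ballI)
  fix \<alpha> g assume a: "\<alpha> \<in> elts \<mu>" and g: "g \<in> elts \<alpha> \<rightarrow> elts \<mu>"
  have "g ` elts \<alpha> \<prec> elts \<mu>" using a mem_lesspoll image_lepoll lesspoll_trans1 by blast
  then obtain \<eta> where "\<eta> \<in> elts \<mu>" "g ` elts \<alpha> \<subseteq> elts \<eta>"
    using bounded[of "g ` elts \<alpha>"] g by blast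
  then show "\<exists>\<beta>\<in>elts \<mu>. \<forall>\<xi>\<in>elts \<alpha>. g \<xi> \<in> elts \<beta>" by blast
qed (use Cardinal infinite in auto)

lemma lesspoll_bounded:
  assumes "X \<prec> elts \<mu>"
  obtains \<theta> \<eta> where "\<eta> \<in> elts \<mu>" "\<theta> \<in> elts \<eta>" "X \<lesssim> elts \<theta>" "X \<inter> elts \<mu> \<subseteq> elts \<eta>"
proof -
  obtain g where g: "inj_on g X" "g ` X \<subseteq> elts \<mu>" using assms unfolding lesspoll_def lepoll_def by blast
  have "g ` X \<prec> elts \<mu>" using assms image_lepoll lesspoll_trans1 by blast
  then obtain \<theta> where \<theta>: "\<theta> \<in> elts \<mu>" "g ` X \<subseteq> elts \<theta>" using bounded g by blast
  have "insert \<theta> (X \<inter> elts \<mu>) \<prec> elts \<mu>"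
    using assms lesspoll_insert lesspoll_trans1 subset_imp_lepoll inf_le1 by metis
  then obtain \<eta> where \<eta>: "\<eta> \<in> elts \<mu>" "insert \<theta> (X \<inter> elts \<mu>) \<subseteq> elts \<eta>"
    using bounded[of "insert \<theta> (X \<inter> elts \<mu>)"] \<theta>(1) by blast
  have "X \<lesssim> elts \<theta>" unfolding lepoll_def using g(1) \<theta>(2) by (intro exI[of _ g] conjI)
  then show thesis using that[of \<eta> \<theta>] \<eta> by simp
qed

lemma countable_lesspoll_meas: "countable A \<Longrightarrow> A \<prec> elts \<mu>"
  using countable_lepoll lesspoll_or_lepoll uncountable by blast

end

section \<open>Sets closed under definable operations\<close>

text \<open>Closure of \<open>X\<close> under \<open>lam_star h\<close> makes the set of values \<open>F(\<xi>)\<close> with \<open>F \<in> X\<close> closed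
  under \<open>h\<close>.\<close>

definition lam_star :: "('a::zfc_universe \<Rightarrow> 'a) \<Rightarrow> 'a \<Rightarrow> 'a" where
  "lam_star h w = lam (pfst w) (\<lambda>\<xi>. h (app (psnd w) \<xi>))"

definition op_pair :: "'a::zfc_universe \<Rightarrow> 'a" where
  "op_pair w = lam (pfst w) (\<lambda>\<xi>. opair (app (pfst (psnd w)) \<xi>) (app (psnd (psnd w)) \<xi>))"

definition op_id :: "'a::zfc_universe \<Rightarrow> 'a" where
  "op_id \<mu> = lam \<mu> (\<lambda>\<xi>. \<xi>)"

definition op_const :: "'a::zfc_universe \<Rightarrow> 'a" where
  "op_const w = lam (pfst w) (\<lambda>\<xi>. psnd w)"

definition op_uf_value :: "'a::zfc_universe \<Rightarrow> 'a" where
  "op_uf_value w = (SOME c. {\<xi>\<in>elts (pfst w). app (psnd w) \<xi> = c} \<in> meas_uf (pfst w))"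

definition next_meas :: "'a::zfc_universe \<Rightarrow> 'a \<Rightarrow> 'a" where
  "next_meas \<kappa> x = (SOME \<mu>. \<mu> \<in> elts \<kappa> \<and> x \<in> elts \<mu> \<and> measurable_cardinal \<mu>)"

definition meas_seq :: "'a::zfc_universe \<Rightarrow> 'a \<Rightarrow> nat \<Rightarrow> 'a" where
  "meas_seq \<kappa> x n = (next_meas \<kappa> ^^ Suc n) x"

definition meas_lim :: "'a::zfc_universe \<Rightarrow> 'a \<Rightarrow> 'a" where
  "meas_lim \<kappa> x = set_of (\<Union>n. elts (meas_seq \<kappa> x n))"

definition op_diff :: "'a::zfc_universe \<Rightarrow> 'a" where
  "op_diff w = (SOME z. z \<in> elts (pfst w) \<longleftrightarrow> z \<notin> elts (psnd w))"

definition op_upair :: "'a::zfc_universe \<Rightarrow> 'a" where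
  "op_upair w = set_of {pfst w, psnd w}"

definition op_app :: "'a::zfc_universe \<Rightarrow> 'a" where
  "op_app w = app (pfst w) (psnd w)"

definition op_preimage :: "'a::zfc_universe \<Rightarrow> 'a" where
  "op_preimage w = (SOME u. opair u (psnd w) \<in> elts (pfst w))"

definition bij_dom :: "'a::zfc_universe \<Rightarrow> 'a" where
  "bij_dom x = (SOME \<beta>. \<beta> \<in> elts x \<and> elts \<beta> \<approx> elts x)"

definition bij_from :: "'a::zfc_universe \<Rightarrow> 'a" where
  "bij_from x = lam (bij_dom x) (SOME g. bij_betw g (elts (bij_dom x)) (elts x))"

definition op_enum :: "nat \<Rightarrow> 'a::zfc_universe \<Rightarrow> 'a" where
  "op_enum n x = from_nat_into (elts x) n"

text \<open>Assignments are coded by iterated pairs, so that Skolem functions become unary operations.\<close>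

definition decode :: "'a::zfc_universe \<Rightarrow> nat \<Rightarrow> 'a" where
  "decode x i = pfst ((psnd ^^ i) x)"

definition op_skolem :: "'a::zfc_universe \<Rightarrow> fm \<Rightarrow> nat \<Rightarrow> 'a \<Rightarrow> 'a" where
  "op_skolem \<kappa> p n x = (SOME y. y \<in> elts (Vset \<kappa>) \<and> \<not> sat (Vset \<kappa>) ((decode x)(n := y)) p)"

definition base_ops :: "'a::zfc_universe \<Rightarrow> ('a \<Rightarrow> 'a) set" where
  "base_ops \<kappa> = {\<lambda>_. \<kappa>, pfst, psnd, op_pair, op_id, op_const, op_uf_value, next_meas \<kappa>,
     meas_lim \<kappa>, op_diff, op_upair, op_app, op_preimage, bij_dom, bij_from}
     \<union> range op_enum \<union> range (\<lambda>(p, n). op_skolem \<kappa> p n)"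

inductive_set ops :: "'a::zfc_universe \<Rightarrow> ('a \<Rightarrow> 'a) set" for \<kappa> where
  base: "h \<in> base_ops \<kappa> \<Longrightarrow> h \<in> ops \<kappa>"
| star: "h \<in> ops \<kappa> \<Longrightarrow> lam_star h \<in> ops \<kappa>"

definition good :: "'a::zfc_universe \<Rightarrow> 'a set \<Rightarrow> bool" where
  "good \<kappa> X \<longleftrightarrow> X \<noteq> {} \<and> (\<forall>x\<in>X. \<forall>y\<in>X. opair x y \<in> X) \<and> (\<forall>h\<in>ops \<kappa>. \<forall>x\<in>X. h x \<in> X)"

instance fm :: countable
  by countable_datatype

lemma countable_base_ops: "countable (base_ops \<kappa>)"
  by (simp add: base_ops_def)

lemma countable_ops: "countable (ops (\<kappa>::'a::zfc_universe))"
proof -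
  have "h \<in> ops \<kappa> \<Longrightarrow> \<exists>n. h \<in> (lam_star ^^ n) ` base_ops \<kappa>" for h :: "'a \<Rightarrow> 'a"
  proof (induction rule: ops.induct)
    case (base h)
    then show ?case by (intro exI[of _ 0]) simp
  next
    case (star h)
    then obtain n where "h \<in> (lam_star ^^ n) ` base_ops \<kappa>" by blast
    then show ?case by (intro exI[of _ "Suc n"]) auto
  qed
  then have "ops \<kappa> \<subseteq> (\<Union>n. (lam_star ^^ n) ` base_ops \<kappa>)" by blast
  moreover have "countable (\<Union>n. (lam_star ^^ n) ` base_ops \<kappa>)"
    using countable_base_ops by (intro countable_UN countable_image) auto
  ultimately show ?thesis using countable_subset by blast
qed

lemma countable_good_exists: "\<exists>X. good \<kappa> X \<and> countable (X::'a::zfc_universe set)"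
proof -
  define C where "C n = rec_nat {\<kappa>} (\<lambda>_ C. C \<union> (\<lambda>(x, y). opair x y) ` (C \<times> C) \<union> (\<lambda>(h, x). h x) ` (ops \<kappa> \<times> C)) n"
    for n :: nat
  have C0: "C 0 = {\<kappa>}" and
    CS: "C (Suc n) = C n \<union> (\<lambda>(x, y). opair x y) ` (C n \<times> C n) \<union> (\<lambda>(h, x). h x) ` (ops \<kappa> \<times> C n)" for n
    by (simp_all add: C_def)
  have cC: "countable (C n)" for n
  proof (induction n)
    case 0
    then show ?case by (simp add: C0)
  next
    case (Suc n)
    then show ?case unfolding CS by (intro countable_Un countable_image countable_SIGMA countable_ops) auto
  qed
  have mono: "m \<le> n \<Longrightarrow> C m \<subseteq> C n" for m n
    by (rule lift_Suc_mono_le[of C]) (auto simp: CS)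
  have "good \<kappa> (\<Union>n. C n)"
    unfolding good_def
  proof (intro conjI ballI)
    show "(\<Union>n. C n) \<noteq> {}" using C0 by blast
  next
    fix x y assume "x \<in> (\<Union>n. C n)" "y \<in> (\<Union>n. C n)"
    then obtain m n where "x \<in> C m" "y \<in> C n" by blast
    then have "x \<in> C (max m n)" "y \<in> C (max m n)" using mono[of m "max m n"] mono[of n "max m n"] by auto
    then have "opair x y \<in> C (Suc (max m n))" unfolding CS by force
    then show "opair x y \<in> (\<Union>n. C n)" by blast
  next
    fix h x assume "h \<in> ops \<kappa>" "x \<in> (\<Union>n. C n)"
    then obtain n where "x \<in> C n" by blast
    then have "h x \<in> C (Suc n)" unfolding CS using \<open>h \<in> ops \<kappa>\<close> by force
    then show "h x \<in> (\<Union>n. C n)" by blast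
  qed
  then show ?thesis using cC by (metis countable_UN countableI_type)
qed

lemma good_opair: "good \<kappa> X \<Longrightarrow> x \<in> X \<Longrightarrow> y \<in> X \<Longrightarrow> opair x y \<in> X"
  by (simp add: good_def)

lemma good_op: "good \<kappa> X \<Longrightarrow> h \<in> ops \<kappa> \<Longrightarrow> x \<in> X \<Longrightarrow> h x \<in> X"
  by (simp add: good_def)

lemma good_base_op: "good \<kappa> X \<Longrightarrow> h \<in> base_ops \<kappa> \<Longrightarrow> x \<in> X \<Longrightarrow> h x \<in> X"
  by (simp add: good_def ops.base)

lemma good_kappa: "good \<kappa> X \<Longrightarrow> \<kappa> \<in> X"
  using good_base_op[of \<kappa> X "\<lambda>_. \<kappa>"] by (force simp: good_def base_ops_def)

lemma good_Union_chain:
  assumes "\<C> \<noteq> {}" "\<And>X. X \<in> \<C> \<Longrightarrow> good \<kappa> X" "\<And>X Y. X \<in> \<C> \<Longrightarrow> Y \<in> \<C> \<Longrightarrow> X \<subseteq> Y \<or> Y \<subseteq> X"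
  shows "good \<kappa> (\<Union>\<C>)"
  unfolding good_def
proof (intro conjI ballI)
  show "\<Union>\<C> \<noteq> {}" using assms(1,2) unfolding good_def by blast
next
  fix x y assume "x \<in> \<Union>\<C>" "y \<in> \<Union>\<C>"
  then obtain X where "X \<in> \<C>" "x \<in> X" "y \<in> X" using assms(3) by blast
  then show "opair x y \<in> \<Union>\<C>" using good_opair assms(2) by blast
next
  fix h x assume "h \<in> ops \<kappa>" "x \<in> \<Union>\<C>"
  then show "h x \<in> \<Union>\<C>" using good_op assms(2) by blast
qed

definition end_ext :: "'a::zfc_universe \<Rightarrow> 'a set \<Rightarrow> 'a set \<Rightarrow> bool" where
  "end_ext \<mu> X X' \<longleftrightarrow> X \<subseteq> X' \<and> (\<forall>x\<in>X \<inter> elts \<mu>. X' \<inter> elts x \<subseteq> X)"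

lemma end_ext_trans: "end_ext \<mu> X Y \<Longrightarrow> end_ext \<mu> Y Z \<Longrightarrow> end_ext \<mu> X Z"
  unfolding end_ext_def by blast

lemma end_ext_subset: "end_ext \<mu> X Y \<Longrightarrow> X \<subseteq> Y"
  by (simp add: end_ext_def)

lemma end_extD: "end_ext \<mu> X Y \<Longrightarrow> x \<in> X \<Longrightarrow> x \<in> elts \<mu> \<Longrightarrow> Y \<inter> elts x = X \<inter> elts x"
  unfolding end_ext_def by blast

lemma (in measurable) op_uf_value_in_U:
  assumes "{\<xi>\<in>elts \<mu>. app F \<xi> = c} \<in> U"
  shows "{\<xi>\<in>elts \<mu>. app F \<xi> = op_uf_value (opair \<mu> F)} \<in> U"
  unfolding op_uf_value_def pfst_opair psnd_opair
  by (rule someI[where P = "\<lambda>c. {\<xi>\<in>elts \<mu>. app F \<xi> = c} \<in> U", OF assms])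

text \<open>Adding a point \<open>\<xi>\<close> that lies in all the relevant members of the ultrafilter makes every
  function in \<open>X\<close> with a value below \<open>\<eta>\<close> at \<open>\<xi>\<close> constant almost everywhere, so \<open>\<xi>\<close> generates
  nothing new below \<open>\<eta>\<close>.\<close>

lemma (in measurable) good_step:
  assumes X: "good \<kappa> X" and \<mu>X: "\<mu> \<in> X" and small: "X \<prec> elts \<mu>"
  shows "\<exists>X'. good \<kappa> X' \<and> end_ext \<mu> X X' \<and> X' \<lesssim> X \<and> \<not> X' \<inter> elts \<mu> \<subseteq> X \<and>
    (\<forall>x\<in>X' - X. Cardinal x \<longrightarrow> X' \<prec> elts x)"
proof -
  obtain \<theta> \<eta> where \<eta>: "\<eta> \<in> elts \<mu>" "\<theta> \<in> elts \<eta>" "X \<lesssim> elts \<theta>" "X \<inter> elts \<mu> \<subseteq> elts \<eta>"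
    using lesspoll_bounded[OF small] by blast
  have O\<eta>: "Ord \<eta>" using \<eta> Ord Ord_mem by blast
  define v where "v F = op_uf_value (opair \<mu> F)" for F
  define B where "B F = {\<xi>\<in>elts \<mu>. app F \<xi> = v F \<or> app F \<xi> \<notin> elts \<eta>}" for F
  have BU: "B F \<in> U" for F
  proof (rule ccontr)
    assume n: "B F \<notin> U"
    have "B F \<subseteq> elts \<mu>" unfolding B_def by blast
    then have "elts \<mu> - B F \<in> U" using n U_ultra by blast
    moreover have "elts \<mu> - B F = (\<Union>c\<in>elts \<eta>. {\<xi>\<in>elts \<mu>. app F \<xi> = c} - B F)"
      unfolding B_def by blast
    ultimately obtain c where c: "{\<xi>\<in>elts \<mu>. app F \<xi> = c} - B F \<in> U"
      using U_UN[OF mem_lesspoll[OF \<eta>(1)], of "\<lambda>c. {\<xi>\<in>elts \<mu>. app F \<xi> = c} - B F"] by auto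
    have "{\<xi>\<in>elts \<mu>. app F \<xi> = c} \<in> U"
    proof (rule ccontr)
      assume "{\<xi>\<in>elts \<mu>. app F \<xi> = c} \<notin> U"
      then have "elts \<mu> - {\<xi>\<in>elts \<mu>. app F \<xi> = c} \<in> U" using U_ultra[of "{\<xi>\<in>elts \<mu>. app F \<xi> = c}"] by blast
      from U_meet[OF this c] show False by blast
    qed
    then have "{\<xi>\<in>elts \<mu>. app F \<xi> = v F} \<in> U" unfolding v_def by (rule op_uf_value_in_U)
    from U_meet[OF this c] show False unfolding B_def by blast
  qed
  have "{\<xi>\<in>elts \<mu>. \<forall>F\<in>X. \<xi> \<in> B F} \<in> U" by (rule U_INT[OF small BU])
  moreover have "X \<inter> elts \<mu> \<notin> U" using small_not_in_U small lesspoll_trans1 subset_imp_lepoll inf_le1 by metis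
  then have "elts \<mu> - X \<inter> elts \<mu> \<in> U" using U_ultra[of "X \<inter> elts \<mu>"] by blast
  ultimately have "{\<xi>\<in>elts \<mu>. \<forall>F\<in>X. \<xi> \<in> B F} \<inter> (elts \<mu> - X \<inter> elts \<mu>) \<noteq> {}" by (rule U_meet)
  then obtain \<xi> where \<xi>: "\<xi> \<in> elts \<mu>" "\<And>F. F \<in> X \<Longrightarrow> \<xi> \<in> B F" "\<xi> \<notin> X" by blast
  define X' where "X' = (\<lambda>F. app F \<xi>) ` X"
  have X'I: "lam \<mu> g \<in> X \<Longrightarrow> g \<xi> \<in> X'" for g
    unfolding X'_def using app_lam[OF \<xi>(1), of g] by (metis image_eqI)
  have sub: "X \<subseteq> X'"
  proof
    fix x assume "x \<in> X"
    then have "op_const (opair \<mu> x) \<in> X"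
      using good_base_op[OF X, of op_const] good_opair[OF X \<mu>X] by (simp add: base_ops_def)
    then show "x \<in> X'" using X'I[of "\<lambda>_. x"] by (simp add: op_const_def)
  qed
  have "op_id \<mu> \<in> X" using good_base_op[OF X _ \<mu>X, of op_id] by (simp add: base_ops_def)
  then have \<xi>X': "\<xi> \<in> X'" using X'I[of "\<lambda>\<xi>. \<xi>"] by (simp add: op_id_def)
  have good: "good \<kappa> X'"
    unfolding good_def
  proof (intro conjI ballI)
    show "X' \<noteq> {}" using \<xi>X' by blast
  next
    fix x y assume "x \<in> X'" "y \<in> X'"
    then obtain F G where FG: "F \<in> X" "x = app F \<xi>" "G \<in> X" "y = app G \<xi>" unfolding X'_def by blast
    then have "op_pair (opair \<mu> (opair F G)) \<in> X"
      using good_base_op[OF X, of op_pair] good_opair[OF X] \<mu>X by (simp add: base_ops_def)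
    then show "opair x y \<in> X'"
      using X'I[of "\<lambda>\<xi>. opair (app F \<xi>) (app G \<xi>)"] FG by (simp add: op_pair_def)
  next
    fix h x assume h: "h \<in> ops \<kappa>" and "x \<in> X'"
    then obtain F where F: "F \<in> X" "x = app F \<xi>" unfolding X'_def by blast
    then have "lam_star h (opair \<mu> F) \<in> X"
      using good_op[OF X ops.star[OF h]] good_opair[OF X] \<mu>X by simp
    then show "h x \<in> X'" using X'I[of "\<lambda>\<xi>. h (app F \<xi>)"] F by (simp add: lam_star_def)
  qed
  have new: "x \<notin> elts \<eta>" if x: "x \<in> X'" "x \<notin> X" for x
  proof -
    obtain F where F: "F \<in> X" "x = app F \<xi>" using x(1) unfolding X'_def by blast
    have "v F \<in> X"
      unfolding v_def using good_base_op[OF X, of op_uf_value] good_opair[OF X \<mu>X F(1)]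
      by (simp add: base_ops_def)
    then show ?thesis using \<xi>(2)[OF F(1)] F(2) x(2) unfolding B_def by auto
  qed
  have le: "X' \<lesssim> X" unfolding X'_def by (rule image_lepoll)
  show ?thesis
  proof (intro exI conjI ballI impI)
    show "end_ext \<mu> X X'"
      unfolding end_ext_def using sub new \<eta>(4) Ord_trans[OF O\<eta>] by blast
    show "\<not> X' \<inter> elts \<mu> \<subseteq> X" using \<xi> \<xi>X' by blast
    fix x assume x: "x \<in> X' - X" "Cardinal x"
    then have "x \<notin> elts \<eta>" using new by blast
    then have "\<theta> \<in> elts x" using Ord_not_mem_iff[OF Cardinal_Ord[OF x(2)] O\<eta>] \<eta>(2) by blast
    then have "elts \<theta> \<prec> elts x" using Cardinal_lesspoll x(2) by blast
    then show "X' \<prec> elts x" using lesspoll_trans1 lepoll_trans le \<eta>(3) by metis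
  qed (use good le in auto)
qed

definition full_cards :: "'a::zfc_universe \<Rightarrow> 'a set \<Rightarrow> 'a set" where
  "full_cards \<mu> X = {x \<in> X \<inter> elts \<mu>. Cardinal x \<and> elts x \<lesssim> X \<inter> elts x}"

lemma full_cards_end_ext:
  assumes "end_ext \<mu> X Y" "x \<in> full_cards \<mu> Y" "x \<in> X"
  shows "x \<in> full_cards \<mu> X"
  using assms end_extD[OF assms(1), of x] by (auto simp: full_cards_def)

lemma full_cards_mono:
  assumes "end_ext \<mu> X Y" "x \<in> full_cards \<mu> X"
  shows "x \<in> full_cards \<mu> Y"
  using assms end_extD[OF assms(1), of x] end_ext_subset[OF assms(1)] by (auto simp: full_cards_def)

lemma full_cards_not_lesspoll: "x \<in> full_cards \<mu> X \<Longrightarrow> X \<prec> elts x \<Longrightarrow> False"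
  unfolding full_cards_def
  by (metis (no_types, lifting) inf_le1 lepoll_not_lesspoll lepoll_trans mem_Collect_eq subset_imp_lepoll)

section \<open>Transfinite chains of end extensions\<close>

function chain :: "'a::zfc_universe set \<Rightarrow> ('a \<Rightarrow> 'a set \<Rightarrow> 'a set) \<Rightarrow> 'a \<Rightarrow> 'a set" where
  "chain X G i = X \<union> (\<Union>j\<in>elts i. G j (chain X G j))"
  by auto
termination
  by (relation "inv_image {(x, y). x \<in> elts y} (\<lambda>(X, G, i). i)") (auto simp: foundation)

declare chain.simps [simp del]

locale measurable_chain = measurable +
  fixes \<kappa> \<tau> :: 'a and X :: "'a set" and G :: "'a \<Rightarrow> 'a set \<Rightarrow> 'a set"
  assumes \<tau>: "\<tau> \<in> elts \<mu> \<or> \<tau> = \<mu>"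
    and X: "good \<kappa> X" "X \<prec> elts \<mu>"
    and step: "\<And>j Y. j \<in> elts \<tau> \<Longrightarrow> good \<kappa> Y \<Longrightarrow> X \<subseteq> Y \<Longrightarrow> Y \<prec> elts \<mu> \<Longrightarrow>
                 good \<kappa> (G j Y) \<and> end_ext \<mu> Y (G j Y) \<and> G j Y \<prec> elts \<mu>"
begin

abbreviation W where "W \<equiv> chain X G"
abbreviation S where "S j \<equiv> G j (W j)"

lemma Ord_\<tau>: "Ord \<tau>" using \<tau> Ord Ord_mem by blast

lemma \<tau>_subset: "elts \<tau> \<subseteq> elts \<mu>" using \<tau> Ord Ord_subset by blast

lemma X_subset_W: "X \<subseteq> W i"
  by (subst chain.simps) blast

lemma S_subset_W: "j \<in> elts i \<Longrightarrow> S j \<subseteq> W i"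
  by (subst chain.simps[of X G i]) blast

lemma W_cases: "x \<in> W i \<Longrightarrow> x \<in> X \<or> (\<exists>j\<in>elts i. x \<in> S j)"
  by (subst (asm) chain.simps) blast

lemma chain_inv:
  "i \<in> elts \<tau> \<or> i = \<tau> \<Longrightarrow>
    good \<kappa> (W i) \<and> (i \<in> elts \<mu> \<longrightarrow> W i \<prec> elts \<mu>) \<and> end_ext \<mu> X (W i) \<and> (\<forall>j\<in>elts i. end_ext \<mu> (S j) (W i))"
proof (induction i rule: mem_induct)
  case (step i)
  have Oi: "Ord i" using step.prems Ord_\<tau> Ord_mem by blast
  have j\<tau>: "j \<in> elts \<tau>" if "j \<in> elts i" for j using step.prems that Ord_\<tau> Ord_trans by blast
  have IH: "good \<kappa> (W j)" "W j \<prec> elts \<mu>" "end_ext \<mu> X (W j)" "\<And>k. k \<in> elts j \<Longrightarrow> end_ext \<mu> (S k) (W j)"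
    if "j \<in> elts i" for j
    using step.IH[OF that] j\<tau>[OF that] \<tau>_subset by auto
  have SP: "good \<kappa> (S j)" "end_ext \<mu> (W j) (S j)" "S j \<prec> elts \<mu>" if "j \<in> elts i" for j
    using measurable_chain.step[OF measurable_chain_axioms j\<tau>[OF that] IH(1)[OF that] X_subset_W IH(2)[OF that]]
    by auto
  have W: "W i = \<Union> (insert X (S ` elts i))" by (subst chain.simps) auto
  have WS: "W j \<subseteq> S j" if "j \<in> elts i" for j using SP(2)[OF that] end_ext_subset by blast
  have mono: "S j \<subseteq> S k" if "j \<in> elts k" "k \<in> elts i" for j k
    using S_subset_W[OF that(1)] WS[OF that(2)] by blast
  have goodW: "good \<kappa> (W i)"
    unfolding W
  proof (rule good_Union_chain)
    fix A B assume AB: "A \<in> insert X (S ` elts i)" "B \<in> insert X (S ` elts i)"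
    have XS: "X \<subseteq> S j" if "j \<in> elts i" for j using X_subset_W[of j] WS[OF that] by blast
    show "A \<subseteq> B \<or> B \<subseteq> A"
    proof (cases "A = X \<or> B = X")
      case True
      then show ?thesis using AB XS by blast
    next
      case False
      then obtain j k where jk: "j \<in> elts i" "A = S j" "k \<in> elts i" "B = S k" using AB by blast
      then have "j \<in> elts k \<or> j = k \<or> k \<in> elts j" using Ord_linear Oi Ord_mem by blast
      then show ?thesis using jk mono by blast
    qed
  qed (use X SP in auto)
  have small: "W i \<prec> elts \<mu>" if "i \<in> elts \<mu>"
    unfolding W
  proof -
    have "(\<Union>A\<in>insert X (S ` elts i). A) \<prec> elts \<mu>"
    proof (rule lesspoll_UN)
      have "S ` elts i \<prec> elts \<mu>" using mem_lesspoll[OF that] image_lepoll lesspoll_trans1 by blast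
      then show "insert X (S ` elts i) \<prec> elts \<mu>"
        by (metis finite_insert infinite finite_lesspoll_infinite infinite_insert_lepoll lesspoll_trans1)
    qed (use X SP in auto)
    then show "\<Union> (insert X (S ` elts i)) \<prec> elts \<mu>" by simp
  qed
  have ee: "end_ext \<mu> (S j) (W i)" if j: "j \<in> elts i" for j
    unfolding end_ext_def
  proof (intro conjI ballI subsetI)
    fix y assume "y \<in> S j" then show "y \<in> W i" using S_subset_W[OF j] by blast
  next
    fix x y assume x: "x \<in> S j \<inter> elts \<mu>" and y: "y \<in> W i \<inter> elts x"
    then consider "y \<in> X" | k where "k \<in> elts i" "y \<in> S k" using W_cases by blast
    then show "y \<in> S j"
    proof cases
      case 1
      then show ?thesis using X_subset_W[of j] WS[OF j] by blast
    next
      case 2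
      have "j \<in> elts k \<or> j = k \<or> k \<in> elts j" using Ord_linear Oi Ord_mem j 2 by blast
      then show ?thesis
      proof (elim disjE)
        assume jk: "j \<in> elts k"
        have "end_ext \<mu> (S j) (S k)" using end_ext_trans[OF IH(4)[OF 2(1) jk] SP(2)[OF 2(1)]] .
        then show ?thesis using 2 x y by (auto simp: end_ext_def)
      qed (use 2 mono j in auto)
    qed
  qed
  have ee0: "end_ext \<mu> X (W i)"
    unfolding end_ext_def
  proof (intro conjI ballI subsetI)
    fix y assume "y \<in> X" then show "y \<in> W i" using X_subset_W by blast
  next
    fix x y assume x: "x \<in> X \<inter> elts \<mu>" and y: "y \<in> W i \<inter> elts x"
    then consider "y \<in> X" | k where "k \<in> elts i" "y \<in> S k" using W_cases by blast
    then show "y \<in> X"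
    proof cases
      case 2
      have "end_ext \<mu> X (S k)" using end_ext_trans[OF IH(3)[OF 2(1)] SP(2)[OF 2(1)]] .
      then show ?thesis using 2 x y by (auto simp: end_ext_def)
    qed
  qed
  show ?case using goodW small ee ee0 by blast
qed

lemma good_W: "good \<kappa> (W \<tau>)" and end_ext_W: "end_ext \<mu> X (W \<tau>)"
  and end_ext_S: "j \<in> elts \<tau> \<Longrightarrow> end_ext \<mu> (S j) (W \<tau>)"
  and small_W: "\<tau> \<in> elts \<mu> \<Longrightarrow> W \<tau> \<prec> elts \<mu>"
  using chain_inv[of \<tau>] by auto

lemma good_Wj: "j \<in> elts \<tau> \<Longrightarrow> good \<kappa> (W j)" and small_Wj: "j \<in> elts \<tau> \<Longrightarrow> W j \<prec> elts \<mu>"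
  using chain_inv[of j] \<tau>_subset by auto

lemma S_step: "j \<in> elts \<tau> \<Longrightarrow> good \<kappa> (S j) \<and> end_ext \<mu> (W j) (S j) \<and> S j \<prec> elts \<mu>"
  using step good_Wj small_Wj X_subset_W by blast

lemma W_le: "W \<tau> \<lesssim> elts \<mu>"
proof (cases "\<tau> \<in> elts \<mu>")
  case True
  then show ?thesis using small_W lesspoll_imp_lepoll by blast
next
  case False
  have "(\<Union>j\<in>elts \<tau>. S j) \<lesssim> elts \<mu>"
    by (rule lepoll_UN_infinite[OF infinite]) (use \<tau>_subset subset_imp_lepoll S_step lesspoll_imp_lepoll in blast)+
  then have "X \<union> (\<Union>j\<in>elts \<tau>. S j) \<lesssim> elts \<mu>"
    using lepoll_Un_infinite[OF infinite] X lesspoll_imp_lepoll by blast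
  then show ?thesis by (subst chain.simps) simp
qed

lemma new_in_W:
  assumes "x \<in> W \<tau>" "x \<notin> X"
  obtains j where "j \<in> elts \<tau>" "x \<in> S j" "x \<notin> W j"
proof -
  obtain m where m: "m \<in> {j\<in>elts \<tau>. x \<in> S j}" "\<And>y. y \<in> elts m \<Longrightarrow> y \<notin> {j\<in>elts \<tau>. x \<in> S j}"
    using mem_minimal[of "{j\<in>elts \<tau>. x \<in> S j}"] W_cases[OF assms(1)] assms(2) by blast
  then have "x \<notin> W m" using W_cases[of x m] assms(2) Ord_trans[OF Ord_\<tau>] by blast
  then show ?thesis using that m(1) by blast
qed

lemma full_cards_W:
  assumes "x \<in> full_cards \<mu> (W \<tau>)" "x \<notin> X"
  obtains j where "j \<in> elts \<tau>" "x \<in> full_cards \<mu> (S j)" "x \<notin> W j"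
proof -
  have "x \<in> W \<tau>" using assms(1) by (simp add: full_cards_def)
  then obtain j where "j \<in> elts \<tau>" "x \<in> S j" "x \<notin> W j" using new_in_W assms(2) by blast
  then show ?thesis using that full_cards_end_ext[OF end_ext_S assms(1)] by blast
qed

lemma lepoll_W:
  assumes "\<And>j. j \<in> elts \<tau> \<Longrightarrow> \<not> S j \<inter> elts \<mu> \<subseteq> W j"
  shows "elts \<tau> \<lesssim> W \<tau> \<inter> elts \<mu>"
proof -
  define c where "c j = (SOME x. x \<in> S j \<inter> elts \<mu> - W j)" for j
  have c: "c j \<in> S j" "c j \<in> elts \<mu>" "c j \<notin> W j" if "j \<in> elts \<tau>" for j
    using someI_ex[of "\<lambda>x. x \<in> S j \<inter> elts \<mu> - W j"] assms[OF that] unfolding c_def by auto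
  have ne: "c j \<noteq> c k" if "j \<in> elts k" "k \<in> elts \<tau>" for j k
  proof -
    have "j \<in> elts \<tau>" using that Ord_trans[OF Ord_\<tau>] by blast
    then have "c j \<in> W k" using c(1) S_subset_W[OF that(1)] by blast
    then show ?thesis using c(3)[OF that(2)] by auto
  qed
  have "inj_on c (elts \<tau>)"
  proof (rule inj_onI)
    fix j k assume "j \<in> elts \<tau>" "k \<in> elts \<tau>" "c j = c k"
    then show "j = k" using ne[of j k] ne[of k j] Ord_linear[of j k] Ord_mem[OF Ord_\<tau>] by auto
  qed
  moreover have "c ` elts \<tau> \<subseteq> W \<tau> \<inter> elts \<mu>" using c S_subset_W by blast
  ultimately show ?thesis unfolding lepoll_def by blast
qed

end

lemma (in measurable) good_extend:
  assumes X: "good \<kappa> X" "\<mu> \<in> X" "X \<prec> elts \<mu>" and \<tau>: "\<tau> \<in> elts \<mu> \<or> \<tau> = \<mu>"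
  shows "\<exists>X'. good \<kappa> X' \<and> end_ext \<mu> X X' \<and> X' \<lesssim> elts \<mu> \<and> (\<tau> \<in> elts \<mu> \<longrightarrow> X' \<prec> elts \<mu>) \<and>
    elts \<tau> \<lesssim> X' \<inter> elts \<mu> \<and> full_cards \<mu> X' \<subseteq> X"
proof -
  define P where "P Y Y' \<longleftrightarrow> good \<kappa> Y' \<and> end_ext \<mu> Y Y' \<and> Y' \<lesssim> Y \<and> \<not> Y' \<inter> elts \<mu> \<subseteq> Y \<and>
    (\<forall>x\<in>Y' - Y. Cardinal x \<longrightarrow> Y' \<prec> elts x)" for Y Y'
  define G where "G j Y = (SOME Y'. P Y Y')" for j :: 'a and Y
  have P: "P Y (G j Y)" if "good \<kappa> Y" "X \<subseteq> Y" "Y \<prec> elts \<mu>" for j Y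
  proof -
    have "\<exists>Y'. P Y Y'" unfolding P_def by (rule good_step) (use that X in auto)
    then show ?thesis unfolding G_def by (rule someI_ex)
  qed
  interpret C: measurable_chain \<mu> \<kappa> \<tau> X G
  proof
    fix j Y assume "good \<kappa> Y" "X \<subseteq> Y" "Y \<prec> elts \<mu>"
    then show "good \<kappa> (G j Y) \<and> end_ext \<mu> Y (G j Y) \<and> G j Y \<prec> elts \<mu>"
      using P[of Y j] lesspoll_trans1[of "G j Y" Y] unfolding P_def by simp
  qed (use X \<tau> in auto)
  have PS: "P (C.W j) (C.S j)" if "j \<in> elts \<tau>" for j
    using P[OF C.good_Wj[OF that] C.X_subset_W C.small_Wj[OF that]] .
  have "full_cards \<mu> (C.W \<tau>) \<subseteq> X"
  proof (rule subsetI, rule ccontr)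
    fix x assume "x \<in> full_cards \<mu> (C.W \<tau>)" "x \<notin> X"
    then obtain j where j: "j \<in> elts \<tau>" "x \<in> full_cards \<mu> (C.S j)" "x \<notin> C.W j" by (rule C.full_cards_W)
    then have "C.S j \<prec> elts x" using PS[OF j(1)] unfolding P_def full_cards_def by blast
    then show False using j(2) full_cards_not_lesspoll by blast
  qed
  moreover have "elts \<tau> \<lesssim> C.W \<tau> \<inter> elts \<mu>"
    by (rule C.lepoll_W) (use PS in \<open>simp add: P_def\<close>)
  ultimately show ?thesis using C.good_W C.end_ext_W C.W_le C.small_W by blast
qed

section \<open>Adding one fixed point\<close>

locale measurable_limit = measurable \<kappa> for \<kappa> :: "'a::zfc_universe" +
  assumes lim: "limit_of_measurables \<kappa>"
begin

lemma next_meas: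
  assumes "x \<in> elts \<kappa>"
  shows "next_meas \<kappa> x \<in> elts \<kappa>" "x \<in> elts (next_meas \<kappa> x)" "measurable_cardinal (next_meas \<kappa> x)"
proof -
  have "\<exists>\<mu>. \<mu> \<in> elts \<kappa> \<and> x \<in> elts \<mu> \<and> measurable_cardinal \<mu>"
    using lim assms unfolding limit_of_measurables_def by blast
  from someI_ex[OF this] show "next_meas \<kappa> x \<in> elts \<kappa>" "x \<in> elts (next_meas \<kappa> x)"
    "measurable_cardinal (next_meas \<kappa> x)"
    unfolding next_meas_def by auto
qed

lemma meas_seq_0: "meas_seq \<kappa> x 0 = next_meas \<kappa> x"
  and meas_seq_Suc: "meas_seq \<kappa> x (Suc n) = next_meas \<kappa> (meas_seq \<kappa> x n)"
  by (simp_all add: meas_seq_def)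

lemma meas_seq:
  assumes "x \<in> elts \<kappa>"
  shows meas_seq_in: "meas_seq \<kappa> x n \<in> elts \<kappa>"
    and measurable_meas_seq: "measurable_cardinal (meas_seq \<kappa> x n)"
  using next_meas assms by (induction n) (auto simp: meas_seq_0 meas_seq_Suc)

lemma meas_seq_less:
  assumes "x \<in> elts \<kappa>" "m < n"
  shows "meas_seq \<kappa> x m \<in> elts (meas_seq \<kappa> x n)"
  using assms(2)
proof (induction n)
  case (Suc n)
  have n: "meas_seq \<kappa> x n \<in> elts (meas_seq \<kappa> x (Suc n))"
    using next_meas(2)[OF meas_seq_in[OF assms(1)]] by (simp add: meas_seq_Suc)
  have "Ord (meas_seq \<kappa> x (Suc n))" using meas_seq_in[OF assms(1)] Ord Ord_mem by blast
  then show ?case using Suc n Ord_trans by (metis less_Suc_eq)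
qed simp

lemma meas_seq_in_good: "good \<kappa> X \<Longrightarrow> x \<in> X \<Longrightarrow> meas_seq \<kappa> x n \<in> X"
  by (induction n) (auto simp: meas_seq_0 meas_seq_Suc base_ops_def intro!: good_base_op[of \<kappa> X "next_meas \<kappa>"])

lemma meas_lim:
  assumes "x \<in> elts \<kappa>"
  shows elts_meas_lim: "elts (meas_lim \<kappa> x) = (\<Union>n. elts (meas_seq \<kappa> x n))"
    and meas_lim_in: "meas_lim \<kappa> x \<in> elts \<kappa>"
    and Cardinal_meas_lim: "Cardinal (meas_lim \<kappa> x)"
    and meas_seq_in_lim: "meas_seq \<kappa> x n \<in> elts (meas_lim \<kappa> x)"
    and not_regular_meas_lim: "\<not> regular_cardinal (meas_lim \<kappa> x)"
proof -
  define l where "l = meas_seq \<kappa> x"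
  define L where "L = meas_lim \<kappa> x"
  have l\<kappa>: "l n \<in> elts \<kappa>" for n unfolding l_def by (rule meas_seq_in[OF assms])
  have "range l \<prec> elts \<kappa>" by (rule countable_lesspoll_meas) auto
  moreover have "range l \<subseteq> elts \<kappa>" using l\<kappa> by blast
  ultimately obtain \<eta> where \<eta>: "\<eta> \<in> elts \<kappa>" "range l \<subseteq> elts \<eta>" using bounded[of "range l"] by blast
  have O\<eta>: "Ord \<eta>" using \<eta> Ord Ord_mem by blast
  have sub: "(\<Union>n. elts (l n)) \<subseteq> elts \<eta>" using \<eta>(2) Ord_trans[OF O\<eta>] by blast
  then have L: "elts L = (\<Union>n. elts (l n))"
    unfolding L_def meas_lim_def l_def[symmetric] by (rule elts_set_of_subset)
  then show "elts (meas_lim \<kappa> x) = (\<Union>n. elts (meas_seq \<kappa> x n))" by (simp add: L_def l_def)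
  have lL: "l n \<in> elts L" for n
    unfolding L l_def using meas_seq_less[OF assms, of n "Suc n"] by blast
  then show "meas_seq \<kappa> x n \<in> elts (meas_lim \<kappa> x)" by (simp add: L_def l_def)
  have Cl: "Cardinal (l n)" for n
    unfolding l_def using measurable.Cardinal[OF measurable.intro[OF measurable_meas_seq[OF assms]]] .
  have OL: "Ord L"
  proof (rule OrdI)
    fix b assume "b \<in> elts L"
    then show "Ord b" using L Ord_mem[OF Cardinal_Ord[OF Cl]] by blast
  next
    fix b c assume "b \<in> elts L" "c \<in> elts b"
    then show "c \<in> elts L" using L Ord_trans[OF Cardinal_Ord[OF Cl]] by blast
  qed
  have "L = \<eta> \<or> L \<in> elts \<eta>" using Ord_subset_iff[OF OL O\<eta>] sub L by blast
  then show "meas_lim \<kappa> x \<in> elts \<kappa>" using \<eta>(1) Ord_trans[OF Ord] unfolding L_def by blast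
  show "Cardinal (meas_lim \<kappa> x)"
    unfolding Cardinal_def L_def[symmetric]
  proof (intro conjI ballI OL)
    fix a assume "a \<in> elts L"
    then obtain n where "a \<in> elts (l n)" using L by blast
    then have "elts a \<prec> elts (l n)" using Cardinal_lesspoll Cl by blast
    also have "elts (l n) \<lesssim> elts L" using L by (intro subset_imp_lepoll) blast
    finally show "\<not> elts a \<approx> elts L" unfolding lesspoll_def by simp
  qed
  show "\<not> regular_cardinal (meas_lim \<kappa> x)"
  proof
    assume "regular_cardinal (meas_lim \<kappa> x)"
    then have reg: "\<forall>\<alpha>\<in>elts L. \<forall>g\<in>elts \<alpha> \<rightarrow> elts L. \<exists>\<beta>\<in>elts L. \<forall>\<xi>\<in>elts \<alpha>. g \<xi> \<in> elts \<beta>"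
      unfolding regular_cardinal_def L_def by blast
    have "infinite (elts (l 0))"
      unfolding l_def using measurable.infinite[OF measurable.intro[OF measurable_meas_seq[OF assms]]] .
    then obtain h :: "nat \<Rightarrow> 'a" where h: "inj h" "range h \<subseteq> elts (l 0)"
      using infinite_countable_subset by blast
    define g where "g u = l (inv h u)" for u
    have "g \<in> elts (l 0) \<rightarrow> elts L" unfolding g_def using lL by blast
    then obtain \<beta> where \<beta>: "\<beta> \<in> elts L" "\<And>\<xi>. \<xi> \<in> elts (l 0) \<Longrightarrow> g \<xi> \<in> elts \<beta>"
      using reg lL[of 0] by blast
    obtain n where n: "\<beta> \<in> elts (l n)" using \<beta>(1) L by blast
    have "g (h n) \<in> elts \<beta>" using \<beta>(2) h(2) by blast
    then have "l n \<in> elts \<beta>" unfolding g_def by (simp add: inv_f_f[OF h(1)])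
    then show False using n mem_not_sym by blast
  qed
qed

text \<open>Since \<open>\<xi>\<close> is above \<open>X \<inter> \<kappa>\<close>, extensions above \<open>\<xi>\<close> do not disturb \<open>X\<close>.\<close>

lemma end_ext_glue:
  assumes e: "end_ext \<kappa> X X1" "end_ext \<mu> X1 Y" and \<xi>: "\<xi> \<in> X1" "\<xi> \<notin> X" "\<xi> \<in> elts \<mu>" "\<mu> \<in> elts \<kappa>"
  shows "end_ext \<kappa> X Y"
  unfolding end_ext_def
proof (intro conjI ballI)
  show "X \<subseteq> Y" using e unfolding end_ext_def by blast
  fix x assume x: "x \<in> X \<inter> elts \<kappa>"
  have O: "Ord x" "Ord \<mu>" using x \<xi> Ord Ord_mem by blast+
  have "x \<in> elts \<mu>"
  proof (rule ccontr)
    assume "x \<notin> elts \<mu>"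
    then have "\<xi> \<in> elts x" using Ord_not_mem_iff O \<xi> by blast
    then show False using e(1) x \<xi> unfolding end_ext_def by blast
  qed
  then show "Y \<inter> elts x \<subseteq> X" using e x unfolding end_ext_def by blast
qed

definition adds_full_card :: "'a set \<Rightarrow> 'a set \<Rightarrow> 'a \<Rightarrow> bool" where
  "adds_full_card X X' \<nu> \<longleftrightarrow> good \<kappa> X' \<and> end_ext \<kappa> X X' \<and> X' \<prec> elts \<kappa> \<and> \<nu> \<notin> X \<and>
     \<nu> \<in> full_cards \<kappa> X' \<and> full_cards \<kappa> X' \<subseteq> insert \<nu> X"

lemma good_step_above:
  assumes X: "good \<kappa> X" "X \<prec> elts \<kappa>"
  obtains X1 \<xi> where "good \<kappa> X1" "end_ext \<kappa> X X1" "X1 \<prec> elts \<kappa>" "\<xi> \<in> X1" "\<xi> \<in> elts \<kappa>" "\<xi> \<notin> X"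
    "\<And>x. x \<in> X1 \<Longrightarrow> x \<notin> X \<Longrightarrow> Cardinal x \<Longrightarrow> X1 \<prec> elts x"
proof -
  obtain X1 where X1: "good \<kappa> X1" "end_ext \<kappa> X X1" "X1 \<lesssim> X" "\<not> X1 \<inter> elts \<kappa> \<subseteq> X"
    "\<forall>x\<in>X1 - X. Cardinal x \<longrightarrow> X1 \<prec> elts x"
    using good_step[OF X(1) good_kappa[OF X(1)] X(2)] by (elim exE conjE)
  have "X1 \<prec> elts \<kappa>" using X1(3) X(2) by (rule lesspoll_trans1)
  with X1 that show ?thesis by blast
qed

lemma above_not_in: "end_ext \<kappa> X X1 \<Longrightarrow> \<xi> \<in> X1 \<Longrightarrow> \<xi> \<notin> X \<Longrightarrow> \<xi> \<in> elts x \<Longrightarrow> x \<in> elts \<kappa> \<Longrightarrow> x \<notin> X"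
  unfolding end_ext_def by blast

lemma add_regular:
  assumes X: "good \<kappa> X" "X \<prec> elts \<kappa>"
  shows "\<exists>X' \<nu>. adds_full_card X X' \<nu> \<and> regular_cardinal \<nu>"
proof -
  obtain X1 \<xi> where X1: "good \<kappa> X1" "end_ext \<kappa> X X1" "X1 \<prec> elts \<kappa>" "\<xi> \<in> X1" "\<xi> \<in> elts \<kappa>" "\<xi> \<notin> X"
    and big: "\<And>x. x \<in> X1 \<Longrightarrow> x \<notin> X \<Longrightarrow> Cardinal x \<Longrightarrow> X1 \<prec> elts x"
    using good_step_above[OF X] by blast
  define \<mu> where "\<mu> = next_meas \<kappa> \<xi>"
  have \<mu>: "\<mu> \<in> elts \<kappa>" "\<xi> \<in> elts \<mu>" "measurable_cardinal \<mu>" unfolding \<mu>_def using next_meas[OF X1(5)] by auto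
  interpret M: measurable \<mu> by (rule measurable.intro[OF \<mu>(3)])
  have \<mu>1: "\<mu> \<in> X1" using meas_seq_in_good[OF X1(1,4), of 0] by (simp add: \<mu>_def meas_seq_0)
  have \<mu>X: "\<mu> \<notin> X" using above_not_in[OF X1(2,4,6) \<mu>(2,1)] .
  have "X1 \<prec> elts \<mu>" using big[OF \<mu>1 \<mu>X M.Cardinal] .
  then obtain X' where X': "good \<kappa> X'" "end_ext \<mu> X1 X'" "X' \<lesssim> elts \<mu>" "elts \<mu> \<lesssim> X' \<inter> elts \<mu>"
    "full_cards \<mu> X' \<subseteq> X1"
    using M.good_extend[OF X1(1) \<mu>1, of \<mu>] by blast
  have "full_cards \<kappa> X' \<subseteq> insert \<mu> X"
  proof (rule subsetI, rule ccontr)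
    fix x assume x: "x \<in> full_cards \<kappa> X'" and n: "x \<notin> insert \<mu> X"
    have Cx: "Cardinal x" using x unfolding full_cards_def by blast
    consider "x \<in> elts \<mu>" | "\<mu> \<in> elts x" using n Ord_linear[OF Cardinal_Ord[OF Cx] M.Ord] by blast
    then show False
    proof cases
      case 1
      then have "x \<in> full_cards \<mu> X'" using x unfolding full_cards_def by blast
      then have "x \<in> X1" "x \<in> full_cards \<mu> X1" using X'(5) full_cards_end_ext[OF X'(2)] by blast+
      then show False using full_cards_not_lesspoll big[OF _ _ Cx] n by blast
    next
      case 2
      then have "X' \<prec> elts x" using Cardinal_lesspoll[OF Cx] X'(3) lesspoll_trans1 by blast
      then show False using x full_cards_not_lesspoll by blast
    qed
  qed
  moreover have "\<mu> \<in> full_cards \<kappa> X'"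
    unfolding full_cards_def using X'(4) \<mu>(1) M.Cardinal \<mu>1 end_ext_subset[OF X'(2)] by blast
  moreover have "X' \<prec> elts \<kappa>" using X'(3) mem_lesspoll[OF \<mu>(1)] by (rule lesspoll_trans1)
  moreover have "end_ext \<kappa> X X'" using end_ext_glue[OF X1(2) X'(2) X1(4,6) \<mu>(2,1)] .
  ultimately show ?thesis unfolding adds_full_card_def using X'(1) \<mu>X M.regular by blast
qed

text \<open>The singular fixed point is the limit of measurable cardinals \<open>l n\<close>. Below \<open>l (n + 1)\<close> the set
  receives at least \<open>l n\<close> many new elements, none of them below \<open>l n\<close>, so it is full at the limit
  but at no cardinal in between.\<close>

lemma add_singular:
  assumes X: "good \<kappa> X" "X \<prec> elts \<kappa>"
  shows "\<exists>X' \<nu>. adds_full_card X X' \<nu> \<and> \<not> regular_cardinal \<nu>"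
proof -
  obtain X1 \<xi> where X1: "good \<kappa> X1" "end_ext \<kappa> X X1" "X1 \<prec> elts \<kappa>" "\<xi> \<in> X1" "\<xi> \<in> elts \<kappa>" "\<xi> \<notin> X"
    and big: "\<And>x. x \<in> X1 \<Longrightarrow> x \<notin> X \<Longrightarrow> Cardinal x \<Longrightarrow> X1 \<prec> elts x"
    using good_step_above[OF X] by blast
  define l where "l = meas_seq \<kappa> \<xi>"
  define L where "L = meas_lim \<kappa> \<xi>"
  note seq = meas_seq_in[OF X1(5), folded l_def] measurable_meas_seq[OF X1(5), folded l_def]
    meas_seq_less[OF X1(5), folded l_def]
  note limit = meas_lim[OF X1(5), folded l_def L_def]
  have M: "measurable (l n)" for n by (rule measurable.intro[OF seq(2)])
  have lX: "l n \<in> X1" for n unfolding l_def by (rule meas_seq_in_good[OF X1(1,4)])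
  have "\<xi> \<in> elts (l 0)" unfolding l_def meas_seq_0 using next_meas(2)[OF X1(5)] .
  have l0: "l 0 \<notin> X" using above_not_in[OF X1(2,4,6) \<open>\<xi> \<in> elts (l 0)\<close> seq(1)] .
  have small: "X1 \<prec> elts (l 0)" using big[OF lX l0 measurable.Cardinal[OF M]] .
  define P where "P n Y \<longleftrightarrow> good \<kappa> Y \<and> X1 \<subseteq> Y \<and> Y \<prec> elts (l n) \<and> (n = 0 \<longrightarrow> Y = X1)" for n Y
  define Q where "Q n Y Y' \<longleftrightarrow> end_ext (l (Suc n)) Y Y' \<and> elts (l n) \<lesssim> Y' \<inter> elts (l (Suc n)) \<and>
    full_cards (l (Suc n)) Y' \<subseteq> Y" for n Y Y'
  have "\<exists>Y. \<forall>n. P n (Y n) \<and> Q n (Y n) (Y (Suc n))"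
  proof (rule dependent_nat_choice)
    show "\<exists>Y. P 0 Y" unfolding P_def using X1(1) small by blast
  next
    fix Y n assume Y: "P n Y"
    have "Y \<prec> elts (l (Suc n))"
      using Y lesspoll_trans measurable.mem_lesspoll[OF M seq(3)] unfolding P_def by blast
    then obtain Y' where "good \<kappa> Y'" "end_ext (l (Suc n)) Y Y'" "Y' \<prec> elts (l (Suc n))"
      "elts (l n) \<lesssim> Y' \<inter> elts (l (Suc n))" "full_cards (l (Suc n)) Y' \<subseteq> Y"
      using measurable.good_extend[OF M, of \<kappa> Y "Suc n" "l n"] Y lX[of "Suc n"] seq(3)[of n "Suc n"]
      unfolding P_def by blast
    then show "\<exists>Y'. P (Suc n) Y' \<and> Q n Y Y'"
      using Y end_ext_subset[of "l (Suc n)" Y Y'] unfolding P_def Q_def by blast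
  qed
  then obtain Y where Y: "\<And>n. P n (Y n)" "\<And>n. Q n (Y n) (Y (Suc n))" by blast
  have Y0: "Y 0 = X1" using Y(1)[of 0] unfolding P_def by simp
  have Yn: "good \<kappa> (Y n)" "X1 \<subseteq> Y n" "Y n \<prec> elts (l n)" for n using Y(1)[of n] unfolding P_def by auto
  have YS: "end_ext (l (Suc n)) (Y n) (Y (Suc n))" "elts (l n) \<lesssim> Y (Suc n) \<inter> elts (l (Suc n))"
    "full_cards (l (Suc n)) (Y (Suc n)) \<subseteq> Y n" for n using Y(2)[of n] unfolding Q_def by auto
  have mono: "m \<le> n \<Longrightarrow> Y m \<subseteq> Y n" for m n
    by (rule lift_Suc_mono_le[of Y]) (use end_ext_subset[OF YS(1)] in auto)
  define X' where "X' = (\<Union>n. Y n)"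
  have stable: "Y n \<inter> elts (l m) = Y m \<inter> elts (l m)" if "m \<le> n" for m n
    using that
  proof (induction n rule: dec_induct)
    case (step n)
    have "l m \<in> elts (l (Suc n))" using step.hyps seq(3) by simp
    then show ?case using end_extD[OF YS(1), of "l m" n] lX Yn(2) step.IH by blast
  qed simp
  have X'l: "X' \<inter> elts (l m) = Y m \<inter> elts (l m)" for m
  proof
    show "X' \<inter> elts (l m) \<subseteq> Y m \<inter> elts (l m)"
    proof
      fix y assume y: "y \<in> X' \<inter> elts (l m)"
      then obtain n where n: "y \<in> Y n" unfolding X'_def by blast
      then have "y \<in> Y (max m n)" using mono[of n "max m n"] by auto
      then show "y \<in> Y m \<inter> elts (l m)" using stable[of m "max m n"] y by auto
    qed
  qed (auto simp: X'_def)
  have good: "good \<kappa> X'"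
    unfolding X'_def
  proof (rule good_Union_chain)
    fix A B assume "A \<in> range Y" "B \<in> range Y"
    then obtain m n where "A = Y m" "B = Y n" by blast
    then show "A \<subseteq> B \<or> B \<subseteq> A" using mono nat_le_linear[of m n] by blast
  qed (use Yn in auto)
  have sub: "Y n \<subseteq> X'" for n unfolding X'_def by blast
  have "end_ext (l 0) X1 X'"
    unfolding end_ext_def using sub[of 0] X'l[of 0] Y0 Ord_trans[OF measurable.Ord[OF M]] by blast
  then have ee: "end_ext \<kappa> X X'"
    using end_ext_glue[OF X1(2) _ X1(4,6) \<open>\<xi> \<in> elts (l 0)\<close> seq(1)] by blast
  have lL: "elts (l n) \<subseteq> elts L" for n unfolding limit(1) by blast
  have infL: "infinite (elts L)" using lL[of 0] measurable.infinite[OF M] finite_subset by blast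
  have X'L: "X' \<lesssim> elts L"
    unfolding X'_def
    by (rule lepoll_UN_infinite[OF infL])
      (use infL infinite_le_lepoll lepoll_trans[OF lesspoll_imp_lepoll[OF Yn(3)] subset_imp_lepoll[OF lL]] in blast)+
  have lX': "elts (l n) \<lesssim> X' \<inter> elts L" for n
    using lepoll_trans[OF YS(2)] subset_imp_lepoll[of "Y (Suc n) \<inter> elts (l (Suc n))" "X' \<inter> elts L"]
      sub[of "Suc n"] lL[of "Suc n"] by blast
  have "infinite (X' \<inter> elts L)"
    using lX'[of 0] measurable.infinite[OF M, of 0] finite_lepoll_infinite
    by (metis finite_lesspoll_infinite lepoll_not_lesspoll)
  then have "elts L \<lesssim> X' \<inter> elts L"
    unfolding limit(1)
    by (intro lepoll_UN_infinite) (use infinite_le_lepoll lX' limit(1) in auto)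
  moreover have "L \<in> X'"
    using good_base_op[OF X1(1) _ X1(4), of "meas_lim \<kappa>"] sub[of 0] Y0 unfolding L_def base_ops_def by blast
  ultimately have Lfull: "L \<in> full_cards \<kappa> X'" unfolding full_cards_def using limit(2,3) by blast
  have LX: "L \<notin> X"
    by (rule above_not_in[OF X1(2,4,6) _ limit(2)]) (use \<open>\<xi> \<in> elts (l 0)\<close> lL in blast)
  have "full_cards \<kappa> X' \<subseteq> insert L X"
  proof (rule subsetI, rule ccontr)
    fix x assume x: "x \<in> full_cards \<kappa> X'" and n: "x \<notin> insert L X"
    have Cx: "Cardinal x" using x unfolding full_cards_def by blast
    consider "x \<in> elts L" | "L \<in> elts x" using n Ord_linear[OF Cardinal_Ord[OF Cx] Cardinal_Ord[OF limit(3)]] by blast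
    then show False
    proof cases
      case 1
      define k where "k = (LEAST n. x \<in> elts (l n))"
      have k: "x \<in> elts (l k)" unfolding k_def using 1 limit(1) by (metis LeastI_ex UN_E)
      have km: "x \<notin> elts (l m)" if "m < k" for m using that not_less_Least unfolding k_def by blast
      have "elts x \<subseteq> elts (l k)" using k Ord_subset[OF measurable.Ord[OF M]] by blast
      then have eq: "X' \<inter> elts x = Y k \<inter> elts x" "x \<in> Y k" using X'l[of k] x k unfolding full_cards_def by blast+
      then have full: "x \<in> full_cards (l k) (Y k)" using x k unfolding full_cards_def by auto
      show False
      proof (cases k)
        case 0
        then have "x \<in> X1" "X1 \<prec> elts x" using eq Y0 big[of x] Cx n by auto
        then show False using full full_cards_not_lesspoll 0 Y0 by auto
      next
        case (Suc m)
        then have "x \<in> Y m" using full YS(3)[of m] by blast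
        then have "x \<in> full_cards (l k) (Y m)" using full_cards_end_ext[OF YS(1)] full Suc by blast
        moreover have "elts (l m) \<subseteq> elts x"
          using km[of m] Suc Ord_not_mem_iff[OF Cardinal_Ord[OF Cx] measurable.Ord[OF M]] by blast
        then have "Y m \<prec> elts x" using lesspoll_trans2[OF Yn(3)] subset_imp_lepoll by blast
        ultimately show False using full_cards_not_lesspoll by blast
      qed
    next
      case 2
      then have "X' \<prec> elts x" using Cardinal_lesspoll[OF Cx] X'L lesspoll_trans1 by blast
      then show False using x full_cards_not_lesspoll by blast
    qed
  qed
  moreover have "X' \<prec> elts \<kappa>" using X'L mem_lesspoll[OF limit(2)] by (rule lesspoll_trans1)
  ultimately show ?thesis
    unfolding adds_full_card_def using good ee LX Lfull limit(5) by blast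
qed

lemma hull_exists:
  assumes \<delta>: "\<delta> \<in> elts \<kappa> \<or> \<delta> = \<kappa>"
  obtains X0 X e where "good \<kappa> X0" "countable X0" "good \<kappa> X" "end_ext \<kappa> X0 X" "X \<lesssim> elts \<kappa>"
    "elts \<kappa> \<lesssim> X \<inter> elts \<kappa>" "full_cards \<kappa> X \<subseteq> X0 \<union> e ` elts \<delta>"
    "\<And>i. i \<in> elts \<delta> \<Longrightarrow> e i \<in> full_cards \<kappa> X \<and> e i \<notin> X0 \<and> (regular_cardinal (e i) \<longleftrightarrow> R i)"
    "\<And>i j. i \<in> elts j \<Longrightarrow> j \<in> elts \<delta> \<Longrightarrow> e i \<in> elts (e j)"
proof -
  obtain X0 where X0: "good \<kappa> X0" "countable X0" using countable_good_exists by blast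
  define P where "P j Y Y' \<longleftrightarrow> (if j \<in> elts \<delta>
    then \<exists>\<nu>. adds_full_card Y Y' \<nu> \<and> (regular_cardinal \<nu> \<longleftrightarrow> R j)
    else good \<kappa> Y' \<and> end_ext \<kappa> Y Y' \<and> Y' \<prec> elts \<kappa> \<and> \<not> Y' \<inter> elts \<kappa> \<subseteq> Y \<and> full_cards \<kappa> Y' \<subseteq> Y)" for j Y Y'
  define G where "G j Y = (SOME Y'. P j Y Y')" for j Y
  have P: "P j Y (G j Y)" if Y: "good \<kappa> Y" "Y \<prec> elts \<kappa>" for j Y
  proof -
    have "\<exists>Y'. P j Y Y'"
    proof (cases "j \<in> elts \<delta>")
      case True
      then show ?thesis unfolding P_def using add_regular[OF Y] add_singular[OF Y] by (cases "R j") auto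
    next
      case False
      obtain Y' \<xi> where Y': "good \<kappa> Y'" "end_ext \<kappa> Y Y'" "Y' \<prec> elts \<kappa>" "\<xi> \<in> Y'" "\<xi> \<in> elts \<kappa>" "\<xi> \<notin> Y"
        and big: "\<And>x. x \<in> Y' \<Longrightarrow> x \<notin> Y \<Longrightarrow> Cardinal x \<Longrightarrow> Y' \<prec> elts x"
        using good_step_above[OF Y] by blast
      have "full_cards \<kappa> Y' \<subseteq> Y"
        using big full_cards_not_lesspoll[of _ \<kappa> Y'] unfolding full_cards_def by blast
      then show ?thesis unfolding P_def using False Y' by auto
    qed
    then show ?thesis unfolding G_def by (rule someI_ex)
  qed
  interpret C: measurable_chain \<kappa> \<kappa> \<kappa> X0 G
  proof
    fix j Y assume "good \<kappa> Y" "X0 \<subseteq> Y" "Y \<prec> elts \<kappa>"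
    then show "good \<kappa> (G j Y) \<and> end_ext \<kappa> Y (G j Y) \<and> G j Y \<prec> elts \<kappa>"
      using P[of Y j] unfolding P_def adds_full_card_def by (auto split: if_splits)
  qed (use X0 countable_lesspoll_meas in auto)
  have PS: "P j (C.W j) (C.S j)" if "j \<in> elts \<kappa>" for j
    using P[OF C.good_Wj[OF that] C.small_Wj[OF that]] .
  define e where "e j = (SOME \<nu>. adds_full_card (C.W j) (C.S j) \<nu> \<and> (regular_cardinal \<nu> \<longleftrightarrow> R j))" for j
  have \<delta>\<kappa>: "elts \<delta> \<subseteq> elts \<kappa>" using \<delta> Ord_subset[OF Ord] by blast
  have e: "adds_full_card (C.W j) (C.S j) (e j)" "regular_cardinal (e j) \<longleftrightarrow> R j" if "j \<in> elts \<delta>" for j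
  proof -
    have "\<exists>\<nu>. adds_full_card (C.W j) (C.S j) \<nu> \<and> (regular_cardinal \<nu> \<longleftrightarrow> R j)"
      using PS[of j] that \<delta>\<kappa> unfolding P_def by auto
    from someI_ex[OF this] show "adds_full_card (C.W j) (C.S j) (e j)" "regular_cardinal (e j) \<longleftrightarrow> R j"
      unfolding e_def by auto
  qed
  have ej: "e j \<in> full_cards \<kappa> (C.S j)" "e j \<notin> C.W j" if "j \<in> elts \<delta>" for j
    using e(1)[OF that] unfolding adds_full_card_def by auto
  have eW: "e j \<in> full_cards \<kappa> (C.W \<kappa>)" if "j \<in> elts \<delta>" for j
    using full_cards_mono[OF C.end_ext_S ej(1)[OF that]] that \<delta>\<kappa> by blast
  have order: "e i \<in> elts (e j)" if ij: "i \<in> elts j" "j \<in> elts \<delta>" for i j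
  proof (rule ccontr)
    assume n: "e i \<notin> elts (e j)"
    have "Ord \<delta>" using \<delta> Ord Ord_mem by blast
    then have i: "i \<in> elts \<delta>" using ij Ord_trans by blast
    have ei: "e i \<in> C.W j" using ej(1)[OF i] C.S_subset_W[OF ij(1)] unfolding full_cards_def by blast
    then have "e i \<noteq> e j" using ej(2)[OF ij(2)] by auto
    moreover have "Ord (e i)" "Ord (e j)" using ej(1) i ij(2) Cardinal_Ord unfolding full_cards_def by blast+
    ultimately have "e j \<in> elts (e i)" using n Ord_linear by blast
    moreover have "e j \<in> C.W \<kappa>" "e i \<in> C.S i \<inter> elts \<kappa>"
      using eW[OF ij(2)] ej(1)[OF i] unfolding full_cards_def by blast+
    ultimately have "e j \<in> C.S i" using C.end_ext_S[of i] i \<delta>\<kappa> unfolding end_ext_def by blast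
    then show False using ej(2)[OF ij(2)] C.S_subset_W[OF ij(1)] by blast
  qed
  have full: "full_cards \<kappa> (C.W \<kappa>) \<subseteq> X0 \<union> e ` elts \<delta>"
  proof
    fix x assume x: "x \<in> full_cards \<kappa> (C.W \<kappa>)"
    show "x \<in> X0 \<union> e ` elts \<delta>"
    proof (cases "x \<in> X0")
      case False
      then obtain j where j: "j \<in> elts \<kappa>" "x \<in> full_cards \<kappa> (C.S j)" "x \<notin> C.W j"
        using C.full_cards_W[OF x] by blast
      show ?thesis
      proof (cases "j \<in> elts \<delta>")
        case True
        then show ?thesis using e(1)[OF True] j unfolding adds_full_card_def by blast
      next
        case False
        then show ?thesis using PS[OF j(1)] j unfolding P_def by auto
      qed
    qed simp
  qed
  have new: "\<not> C.S j \<inter> elts \<kappa> \<subseteq> C.W j" if "j \<in> elts \<kappa>" for j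
  proof (cases "j \<in> elts \<delta>")
    case True
    then show ?thesis using ej[OF True] unfolding full_cards_def by blast
  next
    case False
    then show ?thesis using PS[OF that] unfolding P_def by auto
  qed
  have e0: "e j \<notin> X0" if "j \<in> elts \<delta>" for j using ej(2)[OF that] C.X_subset_W by blast
  show thesis
    by (rule that[of X0 "C.W \<kappa>" e])
      (use X0 C.good_W C.end_ext_W C.W_le C.lepoll_W[OF new] full eW e0 e(2) order in auto)
qed

end

section \<open>The transitive collapse\<close>

function collapse :: "'a::zfc_universe set \<Rightarrow> 'a \<Rightarrow> 'a" where
  "collapse Y x = set_of (collapse Y ` (elts x \<inter> Y))"
  by auto
termination
  by (relation "inv_image {(x, y). x \<in> elts y} snd") (auto simp: foundation)

declare collapse.simps [simp del]

lemma elts_collapse: "elts (collapse Y x) = collapse Y ` (elts x \<inter> Y)"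
  by (subst collapse.simps) (rule elts_set_of_image_subset[of _ x], simp)

lemma collapse_Ord: "Ord x \<Longrightarrow> Ord (collapse Y x) \<and> elts (collapse Y x) \<subseteq> elts (x::'a::zfc_universe)"
proof (induction x rule: mem_induct)
  case (step x)
  have IH: "Ord (collapse Y w)" "elts (collapse Y w) \<subseteq> elts w" if "w \<in> elts x" for w
    using step.IH[OF that] Ord_mem[OF step.prems that] by auto
  have "Ord (collapse Y x)"
  proof (rule OrdI)
    fix b assume "b \<in> elts (collapse Y x)"
    then show "Ord b" using IH unfolding elts_collapse by blast
  next
    fix b c assume "b \<in> elts (collapse Y x)" "c \<in> elts b"
    then obtain w u where "w \<in> elts x" "u \<in> elts w \<inter> Y" "c = collapse Y u"
      unfolding elts_collapse[of Y x] by (auto simp: elts_collapse)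
    then show "c \<in> elts (collapse Y x)"
      using Ord_trans[OF step.prems] unfolding elts_collapse[of Y x] by blast
  qed
  moreover have "collapse Y w \<in> elts x" if "w \<in> elts x" for w
    using IH[OF that] Ord_subset_iff Ord_mem[OF step.prems that] Ord_trans[OF step.prems that] that by metis
  ultimately show ?case unfolding elts_collapse by blast
qed

lemma collapse_subset_Vset:
  "elts x \<subseteq> elts (Vset \<alpha>) \<Longrightarrow> elts (collapse Y x) \<subseteq> elts (Vset (\<alpha>::'a::zfc_universe))"
proof (induction x arbitrary: \<alpha> rule: mem_induct)
  case (step x)
  show ?case
  proof
    fix v assume "v \<in> elts (collapse Y x)"
    then obtain w where w: "w \<in> elts x" "v = collapse Y w" unfolding elts_collapse by blast
    then have "w \<in> elts (Vset \<alpha>)" using step.prems by blast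
    then obtain b where b: "b \<in> elts \<alpha>" "elts w \<subseteq> elts (Vset b)" unfolding elts_Vset[of \<alpha>] by blast
    then show "v \<in> elts (Vset \<alpha>)" using Vset_memI step.IH[OF w(1)] w(2) by blast
  qed
qed

lemma collapse_fixed_initial:
  "elts x \<subseteq> Y \<Longrightarrow> Ord x \<Longrightarrow> collapse Y x = (x::'a::zfc_universe)"
proof (induction x rule: mem_induct)
  case (step x)
  have "collapse Y w = w" if "w \<in> elts x" for w
    using step.IH[OF that] Ord_subset[OF step.prems(2) that] step.prems Ord_mem that by blast
  then have "elts (collapse Y x) = elts x" unfolding elts_collapse using step.prems by force
  then show ?case by (rule extensionality)
qed

lemma sat_cong: "\<exists>k. \<forall>s t. (\<forall>i<k. s i = t i) \<longrightarrow> (sat N s p \<longleftrightarrow> sat N t p)"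
proof (induction p)
  case (Mem m n)
  then show ?case by (intro exI[of _ "Suc (max m n)"]) auto
next
  case (Eq m n)
  then show ?case by (intro exI[of _ "Suc (max m n)"]) auto
next
  case (Neg p)
  then show ?case by auto
next
  case (Conj p q)
  then obtain k l where k: "\<And>s t. (\<forall>i<k. s i = t i) \<Longrightarrow> sat N s p \<longleftrightarrow> sat N t p"
    and l: "\<And>s t. (\<forall>i<l. s i = t i) \<Longrightarrow> sat N s q \<longleftrightarrow> sat N t q" by blast
  have "sat N s (Conj p q) \<longleftrightarrow> sat N t (Conj p q)" if "\<forall>i<max k l. s i = t i" for s t
    using k[of s t] l[of s t] that by simp
  then show ?case by blast
next
  case (All n p)
  then obtain k where k: "\<And>s t. (\<forall>i<k. s i = t i) \<Longrightarrow> sat N s p \<longleftrightarrow> sat N t p" by blast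
  have "sat N (s(n := x)) p \<longleftrightarrow> sat N (t(n := x)) p" if "\<forall>i<k. s i = t i" for s t x
    by (rule k) (use that in auto)
  then have "sat N s (All n p) \<longleftrightarrow> sat N t (All n p)" if "\<forall>i<k. s i = t i" for s t
    using that by (simp only: sat.simps)
  then show ?case by blast
qed

lemma decode_exists:
  "good \<kappa> X \<Longrightarrow> range s \<subseteq> X \<Longrightarrow> \<exists>x\<in>X. \<forall>i<k. decode x i = s i"
proof (induction k arbitrary: s)
  case 0
  then show ?case by auto
next
  case (Suc k)
  from Suc.prems(2) have "range (\<lambda>i. s (Suc i)) \<subseteq> X" by blast
  then obtain x where x: "x \<in> X" "\<forall>i<k. decode x i = s (Suc i)" using Suc by blast
  have "decode (opair (s 0) x) i = s i" if "i < Suc k" for i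
    using x(2) that by (cases i) (auto simp: decode_def funpow_swap1)
  moreover have "opair (s 0) x \<in> X" using good_opair Suc.prems x by blast
  ultimately show ?case by blast
qed

locale collapsed_hull = measurable_limit +
  fixes X :: "'a set"
  assumes good_X: "good \<kappa> X"
begin

definition Y where "Y = X \<inter> elts (Vset \<kappa>)"

abbreviation \<pi> where "\<pi> \<equiv> collapse Y"

definition M where "M = set_of (\<pi> ` Y)"

definition j where "j = inv_into Y \<pi>"

lemma elts_M: "elts M = \<pi> ` Y"
  unfolding M_def by (rule elts_set_of_image_subset[of _ "Vset \<kappa>"]) (simp add: Y_def)

lemma YI: "x \<in> X \<Longrightarrow> y \<in> elts (Vset \<kappa>) \<Longrightarrow> x \<in> elts y \<Longrightarrow> x \<in> Y"
  unfolding Y_def using Vset_trans[OF Ord] by blast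

lemma op_X: "h \<in> base_ops \<kappa> \<Longrightarrow> x \<in> X \<Longrightarrow> h x \<in> X"
  using good_base_op[OF good_X] .

lemma opair_X: "x \<in> X \<Longrightarrow> y \<in> X \<Longrightarrow> opair x y \<in> X"
  using good_opair[OF good_X] .

lemma Y_extensional:
  assumes "x \<in> Y" "y \<in> Y" "x \<noteq> y"
  obtains z where "z \<in> Y" "z \<in> elts x \<longleftrightarrow> z \<notin> elts y"
proof -
  define z where "z = op_diff (opair x y)"
  have "\<exists>z. z \<in> elts x \<longleftrightarrow> z \<notin> elts y" using assms(3) extensionality[of x y] by blast
  from someI_ex[OF this] have z: "z \<in> elts x \<longleftrightarrow> z \<notin> elts y" unfolding z_def op_diff_def by simp
  have "z \<in> X"
    unfolding z_def by (rule op_X) (use assms opair_X in \<open>auto simp: base_ops_def Y_def\<close>)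
  then have "z \<in> Y" using YI z assms unfolding Y_def by blast
  then show ?thesis using that z by blast
qed

lemma collapse_inject: "x \<in> Y \<Longrightarrow> y \<in> Y \<Longrightarrow> \<pi> x = \<pi> y \<Longrightarrow> x = y"
proof (induction x arbitrary: y rule: mem_induct)
  case (step x)
  show ?case
  proof (rule ccontr)
    assume "x \<noteq> y"
    then obtain z where z: "z \<in> Y" "z \<in> elts x \<longleftrightarrow> z \<notin> elts y" using Y_extensional step.prems by blast
    have eq: "\<pi> ` (elts x \<inter> Y) = \<pi> ` (elts y \<inter> Y)" using step.prems(3) by (metis elts_collapse)
    show False
    proof (cases "z \<in> elts x")
      case True
      then obtain w where "w \<in> elts y \<inter> Y" "\<pi> z = \<pi> w" using eq z(1) by blast
      then show False using step.IH[OF True z(1)] True z(2) by blast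
    next
      case False
      then obtain w where "w \<in> elts x \<inter> Y" "\<pi> z = \<pi> w" using eq z by blast
      then show False using step.IH[of w z] False z by auto
    qed
  qed
qed

lemma inj_collapse: "inj_on \<pi> Y"
  using collapse_inject by (rule inj_onI)

lemma j_collapse: "y \<in> Y \<Longrightarrow> j (\<pi> y) = y"
  unfolding j_def by (rule inv_into_f_f[OF inj_collapse])

lemma collapse_j: "x \<in> elts M \<Longrightarrow> j x \<in> Y \<and> \<pi> (j x) = x"
  unfolding elts_M using j_collapse by auto

lemma collapse_mem: "x \<in> Y \<Longrightarrow> y \<in> Y \<Longrightarrow> \<pi> x \<in> elts (\<pi> y) \<longleftrightarrow> x \<in> elts y"
  unfolding elts_collapse using collapse_inject by blast

lemma sat_collapse:
  "range s \<subseteq> Y \<Longrightarrow> sat M (\<pi> \<circ> s) p \<longleftrightarrow> sat (Vset \<kappa>) s p"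
proof (induction p arbitrary: s)
  case (Mem m n)
  then have "s m \<in> Y" "s n \<in> Y" by auto
  then show ?case using collapse_mem by simp
next
  case (Eq m n)
  then have "s m \<in> Y" "s n \<in> Y" by auto
  then show ?case using collapse_inject by auto
next
  case (All n p)
  have sub: "range (s(n := y)) \<subseteq> Y" if "y \<in> Y" for y using All.prems that by auto
  have "sat M (\<pi> \<circ> s) (All n p) \<longleftrightarrow> (\<forall>y\<in>Y. sat M ((\<pi> \<circ> s)(n := \<pi> y)) p)"
    by (simp add: elts_M)
  also have "\<dots> \<longleftrightarrow> (\<forall>y\<in>Y. sat M (\<pi> \<circ> (s(n := y))) p)" by (simp add: fun_upd_comp)
  also have "\<dots> \<longleftrightarrow> (\<forall>y\<in>Y. sat (Vset \<kappa>) (s(n := y)) p)" using All.IH sub by blast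
  also have "\<dots> \<longleftrightarrow> sat (Vset \<kappa>) s (All n p)"
  proof
    assume a: "\<forall>y\<in>Y. sat (Vset \<kappa>) (s(n := y)) p"
    show "sat (Vset \<kappa>) s (All n p)"
    proof (rule ccontr)
      assume "\<not> ?thesis"
      then obtain y where y: "y \<in> elts (Vset \<kappa>)" "\<not> sat (Vset \<kappa>) (s(n := y)) p" by auto
      obtain k where k: "\<And>s t. (\<forall>i<k. s i = t i) \<Longrightarrow> sat (Vset \<kappa>) s p \<longleftrightarrow> sat (Vset \<kappa>) t p"
        using sat_cong[of "Vset \<kappa>" p] by blast
      have "range s \<subseteq> X" using All.prems unfolding Y_def by blast
      then obtain x where x: "x \<in> X" "\<forall>i<k. decode x i = s i" using decode_exists[OF good_X] by blast
      have eq: "sat (Vset \<kappa>) ((decode x)(n := u)) p \<longleftrightarrow> sat (Vset \<kappa>) (s(n := u)) p" for u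
        by (rule k) (use x(2) in auto)
      define w where "w = op_skolem \<kappa> p n x"
      have "\<exists>y. y \<in> elts (Vset \<kappa>) \<and> \<not> sat (Vset \<kappa>) ((decode x)(n := y)) p" using y eq by blast
      from someI_ex[OF this] have w: "w \<in> elts (Vset \<kappa>)" "\<not> sat (Vset \<kappa>) ((decode x)(n := w)) p"
        unfolding w_def op_skolem_def by auto
      have "op_skolem \<kappa> p n \<in> base_ops \<kappa>" unfolding base_ops_def by force
      then have "w \<in> X" unfolding w_def using op_X x(1) by blast
      then show False using a w eq unfolding Y_def by blast
    qed
  qed (simp add: Y_def)
  finally show ?case .
qed auto

lemma Transset_M: "Transset M"
  unfolding Transset_def elts_M by (auto simp: elts_collapse)

lemma M_subset: "elts M \<subseteq> elts (Vset \<kappa>)"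
proof
  fix x assume "x \<in> elts M"
  then obtain y where y: "y \<in> Y" "x = \<pi> y" unfolding elts_M by blast
  then obtain b where "b \<in> elts \<kappa>" "elts y \<subseteq> elts (Vset b)" unfolding Y_def elts_Vset[of \<kappa>] by blast
  then show "x \<in> elts (Vset \<kappa>)" using collapse_subset_Vset Vset_memI y(2) by blast
qed

lemma elementary: "elementary_embedding j M (Vset \<kappa>)"
  unfolding elementary_embedding_def
proof (intro conjI allI impI)
  show "j \<in> elts M \<rightarrow> elts (Vset \<kappa>)" using collapse_j unfolding Y_def by blast
  fix p :: fm and s :: "nat \<Rightarrow> 'a" assume s: "range s \<subseteq> elts M"
  have "s i \<in> elts M" for i using s by blast
  then have js: "j (s i) \<in> Y \<and> \<pi> (j (s i)) = s i" for i using collapse_j by blast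
  then have "s = \<pi> \<circ> (j \<circ> s)" by (simp add: fun_eq_iff)
  moreover have "range (j \<circ> s) \<subseteq> Y" using js by auto
  ultimately show "sat M s p \<longleftrightarrow> sat (Vset \<kappa>) (j \<circ> s) p" using sat_collapse by metis
qed

lemma collapse_opair:
  assumes "u \<in> X" "v \<in> X" "opair u v \<in> elts (Vset \<kappa>)"
  shows "\<pi> (opair u v) = opair (\<pi> u) (\<pi> v)"
proof -
  have up: "\<pi> (set_of {x, y}) = set_of {\<pi> x, \<pi> y}" if "x \<in> Y" "y \<in> Y" for x y
    by (rule extensionality) (use that in \<open>simp add: elts_collapse\<close>)
  have upX: "set_of {x, y} \<in> X" if "x \<in> X" "y \<in> X" for x y
    using op_X[of op_upair "opair x y"] opair_X[OF that] by (simp add: op_upair_def base_ops_def)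
  have V: "set_of {u, u} \<in> elts (Vset \<kappa>)" "set_of {u, v} \<in> elts (Vset \<kappa>)"
    using Vset_trans[OF Ord assms(3)] by (auto simp: opair_def)
  then have "u \<in> Y" "v \<in> Y" using Vset_trans[OF Ord V(2)] assms(1,2) by (auto simp: Y_def)
  moreover have "set_of {u, u} \<in> Y" "set_of {u, v} \<in> Y" using V upX assms(1,2) unfolding Y_def by blast+
  ultimately show ?thesis unfolding opair_def by (simp only: up)
qed

lemma cardinal_in_M:
  assumes x: "x \<in> Y" "Ord x" and c: "cardinal_in M (\<pi> x)"
  shows "Cardinal x"
proof (rule ccontr)
  assume "\<not> Cardinal x"
  then have "\<exists>\<beta>. \<beta> \<in> elts x \<and> elts \<beta> \<approx> elts x" using x(2) unfolding Cardinal_def by blast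
  define \<beta> where "\<beta> = bij_dom x"
  define g where "g = (SOME g. bij_betw g (elts \<beta>) (elts x))"
  define b where "b = bij_from x"
  have \<beta>: "\<beta> \<in> elts x" "elts \<beta> \<approx> elts x"
    using someI_ex[OF \<open>\<exists>\<beta>. \<beta> \<in> elts x \<and> elts \<beta> \<approx> elts x\<close>] unfolding \<beta>_def bij_dom_def by auto
  have g: "bij_betw g (elts \<beta>) (elts x)"
    using someI_ex[OF \<beta>(2)[unfolded eqpoll_def]] unfolding g_def .
  have b: "elts b = (\<lambda>u. opair u (g u)) ` elts \<beta>"
    unfolding b_def bij_from_def \<beta>_def[symmetric] g_def[symmetric] lam_def by simp
  have xX: "x \<in> X" "x \<in> elts (Vset \<kappa>)" using x unfolding Y_def by auto
  have \<beta>X: "\<beta> \<in> X" and bX: "b \<in> X"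
    unfolding \<beta>_def b_def by (rule op_X[OF _ xX(1)], simp add: base_ops_def)+
  have \<beta>Y: "\<beta> \<in> Y" using YI[OF \<beta>X xX(2) \<beta>(1)] .
  have x\<kappa>: "x \<in> elts \<kappa>" using Ord_in_Vset[OF Ord x(2) xX(2)] .
  define c1 where "c1 = next_meas \<kappa> x"
  define c2 where "c2 = next_meas \<kappa> c1"
  have c12: "x \<in> elts c1" "c1 \<in> elts c2" "c2 \<in> elts \<kappa>"
    unfolding c1_def c2_def using next_meas[OF x\<kappa>] next_meas by auto
  have "opair u v \<in> elts (Vset c2)" if "u \<in> elts x" "v \<in> elts x" for u v
  proof -
    have "u \<in> elts (Vset x)" "v \<in> elts (Vset x)" using that Ord_subset_Vset[OF x(2)] by auto
    then show ?thesis unfolding opair_def using upair_in_Vset[OF c12(1)] upair_in_Vset[OF c12(2)] by blast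
  qed
  moreover have gx: "g u \<in> elts x" if "u \<in> elts \<beta>" for u using g that unfolding bij_betw_def by blast
  moreover have \<beta>x: "elts \<beta> \<subseteq> elts x" using Ord_subset[OF x(2) \<beta>(1)] .
  ultimately have "elts b \<subseteq> elts (Vset c2)" unfolding b by blast
  then have bV: "b \<in> elts (Vset \<kappa>)" by (rule Vset_memI[OF c12(3)])
  have bY: "b \<in> Y" using bX bV unfolding Y_def by blast
  have app_b: "op_app (opair b u) = g u" if "u \<in> elts \<beta>" for u
    unfolding op_app_def using app_eq[OF b that] by simp
  have gY: "g u \<in> Y" if u: "u \<in> elts \<beta>" "u \<in> Y" for u
  proof -
    have "op_app (opair b u) \<in> X"
      by (rule op_X) (use bX u opair_X in \<open>auto simp: base_ops_def Y_def\<close>)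
    then show ?thesis using app_b[OF u(1)] YI[OF _ xX(2) gx[OF u(1)]] by simp
  qed
  have preY: "\<exists>u\<in>elts \<beta> \<inter> Y. g u = v" if v: "v \<in> elts x" "v \<in> Y" for v
  proof -
    define u where "u = op_preimage (opair b v)"
    obtain t where "t \<in> elts \<beta>" "v = g t" using v(1) g unfolding bij_betw_def by blast
    then have "\<exists>u. opair u v \<in> elts b" unfolding b by blast
    from someI_ex[OF this] have "opair u v \<in> elts b" unfolding u_def op_preimage_def by simp
    then have u: "u \<in> elts \<beta>" "g u = v" unfolding b by auto
    have "u \<in> X"
      unfolding u_def by (rule op_X) (use bX v opair_X in \<open>auto simp: base_ops_def Y_def\<close>)
    then have "u \<in> Y" using YI[OF _ xX(2)] u(1) \<beta>x by blast
    then show ?thesis using u by blast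
  qed
  define g' where "g' w = \<pi> (g (j w))" for w
  have g': "g' (\<pi> u) = \<pi> (g u)" if "u \<in> Y" for u unfolding g'_def using j_collapse[OF that] by simp
  have "bij_betw g' (elts (\<pi> \<beta>)) (elts (\<pi> x))"
    unfolding bij_betw_def
  proof
    show "inj_on g' (elts (\<pi> \<beta>))"
    proof (rule inj_onI)
      fix w z assume "w \<in> elts (\<pi> \<beta>)" "z \<in> elts (\<pi> \<beta>)" and eq: "g' w = g' z"
      then obtain u v where uv: "u \<in> elts \<beta>" "u \<in> Y" "w = \<pi> u" "v \<in> elts \<beta>" "v \<in> Y" "z = \<pi> v"
        unfolding elts_collapse by blast
      then have "g u = g v" using eq g' collapse_inject gY by simp
      then have "u = v" using g uv unfolding bij_betw_def inj_on_def by blast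
      then show "w = z" using uv by simp
    qed
    have "g' ` \<pi> ` (elts \<beta> \<inter> Y) = \<pi> ` g ` (elts \<beta> \<inter> Y)" using g' by (force simp: image_iff)
    moreover have "g ` (elts \<beta> \<inter> Y) = elts x \<inter> Y" using gx gY preY by blast
    ultimately show "g' ` elts (\<pi> \<beta>) = elts (\<pi> x)" unfolding elts_collapse by simp
  qed
  moreover have "elts (\<pi> b) = (\<lambda>w. opair w (g' w)) ` elts (\<pi> \<beta>)"
  proof -
    have "elts b \<inter> Y = (\<lambda>u. opair u (g u)) ` (elts \<beta> \<inter> Y)"
    proof (intro equalityI subsetI)
      fix w assume w: "w \<in> elts b \<inter> Y"
      then obtain u where u: "u \<in> elts \<beta>" "w = opair u (g u)" unfolding b by blast
      have "pfst w \<in> X" by (rule op_X) (use w in \<open>auto simp: base_ops_def Y_def\<close>)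
      then have "u \<in> Y" using u YI[OF _ xX(2)] \<beta>x by auto
      then show "w \<in> (\<lambda>u. opair u (g u)) ` (elts \<beta> \<inter> Y)" using u by blast
    next
      fix w assume "w \<in> (\<lambda>u. opair u (g u)) ` (elts \<beta> \<inter> Y)"
      then obtain u where u: "u \<in> elts \<beta>" "u \<in> Y" "w = opair u (g u)" by blast
      then have "w \<in> elts b" unfolding b by blast
      moreover have "w \<in> X" using u gY opair_X unfolding Y_def by blast
      ultimately show "w \<in> elts b \<inter> Y" using YI[OF _ bV] by blast
    qed
    moreover have "\<pi> (opair u (g u)) = opair (\<pi> u) (g' (\<pi> u))" if u: "u \<in> elts \<beta> \<inter> Y" for u
    proof -
      have "opair u (g u) \<in> elts (Vset \<kappa>)" using Vset_trans[OF Ord bV] b u by blast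
      then show ?thesis using collapse_opair[of u "g u"] u gY g' unfolding Y_def by simp
    qed
    ultimately show ?thesis unfolding elts_collapse by (simp add: image_image)
  qed
  ultimately have "is_bijection (\<pi> b) (\<pi> \<beta>) (\<pi> x)" unfolding is_bijection_def by blast
  moreover have "\<pi> \<beta> \<in> elts (\<pi> x)" using collapse_mem[OF \<beta>Y x(1)] \<beta>(1) by blast
  moreover have "\<pi> b \<in> elts M" unfolding elts_M using bY by blast
  ultimately show False using c unfolding cardinal_in_def by blast
qed

lemma Ord_Y: "x \<in> Y \<Longrightarrow> Ord x \<Longrightarrow> x \<in> elts \<kappa>"
  using Ord_in_Vset[OF Ord] unfolding Y_def by blast

lemma Int_Y: "x \<in> elts \<kappa> \<Longrightarrow> elts x \<inter> Y = X \<inter> elts x"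
  unfolding Y_def using Ord_subset_Vset[OF Ord] Ord_trans[OF Ord] by blast

lemma full_cards_fixed:
  assumes "x \<in> full_cards \<kappa> X"
  shows "x \<in> Y" "\<pi> x = x" "j x = x"
proof -
  have x: "x \<in> X" "x \<in> elts \<kappa>" "Cardinal x" "elts x \<lesssim> X \<inter> elts x" using assms unfolding full_cards_def by auto
  then show xY: "x \<in> Y" unfolding Y_def using Ord_subset_Vset[OF Ord] by blast
  have "\<pi> ` (elts x \<inter> Y) \<approx> elts x \<inter> Y"
    by (rule inj_on_image_eqpoll_self) (rule inj_on_subset[OF inj_collapse], blast)
  then have le: "elts x \<lesssim> elts (\<pi> x)"
    using x(4) unfolding elts_collapse Int_Y[OF x(2)] by (metis eqpoll_sym lepoll_trans2)
  have O: "Ord (\<pi> x)" "elts (\<pi> x) \<subseteq> elts x" using collapse_Ord[OF Cardinal_Ord[OF x(3)]] by auto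
  have "\<pi> x \<notin> elts x" using Cardinal_lesspoll[OF x(3)] le lepoll_not_lesspoll by blast
  then show "\<pi> x = x" using O Ord_subset_iff[OF O(1) Cardinal_Ord[OF x(3)]] by blast
  then show "j x = x" using j_collapse[OF xY] by simp
qed

lemma fixed_full_cards:
  assumes "cardinal_in M x" "j x = x"
  shows "x \<in> full_cards \<kappa> X"
proof -
  have x: "x \<in> elts M" "Ord x" using assms(1) unfolding cardinal_in_def by auto
  then have xY: "x \<in> Y" "\<pi> x = x" using collapse_j[OF x(1)] assms(2) by auto
  have "elts x = \<pi> ` (elts x \<inter> Y)" using elts_collapse[of Y x] xY(2) by simp
  then have "elts x \<lesssim> elts x \<inter> Y" by (metis image_lepoll)
  moreover have "Cardinal x" using cardinal_in_M xY x(2) assms(1) by simp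
  moreover have "x \<in> elts \<kappa>" using Ord_Y xY(1) x(2) by blast
  ultimately show ?thesis using xY(1) Int_Y unfolding full_cards_def Y_def by auto
qed

lemma cardinal_in_M_I:
  assumes "Cardinal x" "x \<in> elts M"
  shows "cardinal_in M x"
  unfolding cardinal_in_def
proof (intro conjI notI)
  assume "\<exists>\<beta>\<in>elts x. \<exists>b\<in>elts M. is_bijection b \<beta> x"
  then obtain \<beta> where "\<beta> \<in> elts x" "elts \<beta> \<approx> elts x" unfolding is_bijection_def eqpoll_def by blast
  then show False using assms(1) unfolding Cardinal_def by blast
qed (use assms Cardinal_Ord in auto)

lemma is_crit_exists:
  assumes "v \<in> elts M" "Ord v" "j v \<noteq> v"
  obtains \<gamma> where "is_crit M j \<gamma>" "\<gamma> = v \<or> \<gamma> \<in> elts v"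
proof -
  obtain \<gamma> where \<gamma>: "\<gamma> \<in> {\<beta>\<in>elts M. Ord \<beta> \<and> j \<beta> \<noteq> \<beta>}"
    "\<And>y. y \<in> elts \<gamma> \<Longrightarrow> y \<notin> {\<beta>\<in>elts M. Ord \<beta> \<and> j \<beta> \<noteq> \<beta>}"
    using mem_minimal[of "{\<beta>\<in>elts M. Ord \<beta> \<and> j \<beta> \<noteq> \<beta>}"] assms by blast
  have "is_crit M j \<gamma>" unfolding is_crit_def using \<gamma> Ord_linear by blast
  moreover from this have "\<gamma> = v \<or> \<gamma> \<in> elts v" using assms unfolding is_crit_def by blast
  ultimately show ?thesis using that by blast
qed

lemma is_crit_not_countable:
  assumes "is_crit M j \<gamma>" "x \<in> Y" "Ord x" "\<gamma> \<in> elts x"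
  shows "uncountable (elts x)"
proof
  assume c: "countable (elts x)"
  have "u \<in> Y" if u: "u \<in> elts x" for u
  proof -
    obtain n where "u = from_nat_into (elts x) n" using from_nat_into_surj[OF c u] by metis
    then have "u = op_enum n x" unfolding op_enum_def .
    then have "u \<in> X" using op_X[of "op_enum n" x] assms(2) unfolding base_ops_def Y_def by blast
    then show ?thesis using YI[OF _ _ u] assms(2) unfolding Y_def by blast
  qed
  then have "elts \<gamma> \<subseteq> Y" "\<gamma> \<in> Y" using Ord_subset[OF assms(3,4)] assms(4) by blast+
  then have "j \<gamma> = \<gamma>"
    using collapse_fixed_initial[of \<gamma> Y] j_collapse[of \<gamma>] Ord_mem[OF assms(3,4)] by simp
  then show False using assms(1) unfolding is_crit_def by blast
qed

lemma M_eqpoll: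
  assumes "X \<lesssim> elts \<kappa>" "elts \<kappa> \<lesssim> X \<inter> elts \<kappa>"
  shows "elts M \<approx> elts \<kappa>"
proof -
  have "elts M \<approx> Y" unfolding elts_M by (rule inj_on_image_eqpoll_self[OF inj_collapse])
  also have "Y \<approx> elts \<kappa>"
  proof (rule lepoll_antisym)
    show "Y \<lesssim> elts \<kappa>" using lepoll_trans[OF subset_imp_lepoll assms(1)] unfolding Y_def by blast
    have "X \<inter> elts \<kappa> \<subseteq> Y" unfolding Y_def using Ord_subset_Vset[OF Ord] by blast
    then show "elts \<kappa> \<lesssim> Y" using lepoll_trans[OF assms(2) subset_imp_lepoll] by blast
  qed
  finally show ?thesis .
qed

end

theorem theorem3p2:
  fixes \<kappa> \<delta> :: "'v::zfc_universe" and f :: "'v \<Rightarrow> nat"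
  assumes "measurable_cardinal \<kappa>" and "limit_of_measurables \<kappa>"
    and "Ord \<delta>" and "\<delta> \<in> elts \<kappa> \<or> \<delta> = \<kappa>"
    and "f \<in> elts \<delta> \<rightarrow> {0, 1}"
  shows "\<exists>M j \<gamma>.
           Transset M \<and> elts M \<subseteq> elts (Vset \<kappa>) \<and> elts M \<approx> elts \<kappa> \<and>
           elementary_embedding j M (Vset \<kappa>) \<and> is_crit M j \<gamma> \<and>
           (\<exists>e. enumerates e \<delta> (fixed_cardinals M j \<gamma>) \<and>
                (\<forall>\<alpha>\<in>elts \<delta>. regular_cardinal (e \<alpha>) \<longleftrightarrow> f \<alpha> = 1))"
proof -
  interpret K: measurable_limit \<kappa>
    by (intro measurable_limit.intro measurable.intro measurable_limit_axioms.intro assms)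
  obtain X0 X e where X0: "good \<kappa> X0" "countable X0" and X: "good \<kappa> X" "end_ext \<kappa> X0 X" "X \<lesssim> elts \<kappa>"
      "elts \<kappa> \<lesssim> X \<inter> elts \<kappa>" "full_cards \<kappa> X \<subseteq> X0 \<union> e ` elts \<delta>"
    and e: "\<And>i. i \<in> elts \<delta> \<Longrightarrow> e i \<in> full_cards \<kappa> X \<and> e i \<notin> X0 \<and> (regular_cardinal (e i) \<longleftrightarrow> f i = 1)"
    and order: "\<And>i j. i \<in> elts j \<Longrightarrow> j \<in> elts \<delta> \<Longrightarrow> e i \<in> elts (e j)"
    using K.hull_exists[OF assms(4), of "\<lambda>i. f i = 1"] by blast
  interpret H: collapsed_hull \<kappa> X
    by (intro collapsed_hull.intro K.measurable_limit_axioms collapsed_hull_axioms.intro X(1))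
  have count: "countable (X \<inter> elts x)" if "x \<in> X0" "x \<in> elts \<kappa>" for x
    using end_extD[OF X(2) that] X0(2) by (metis countable_Int1)
  define u where "u = next_meas \<kappa> (op_enum 0 \<kappa>)"
  have "op_enum 0 \<kappa> \<in> elts \<kappa>"
    unfolding op_enum_def by (rule from_nat_into) (use K.infinite in auto)
  note u = K.next_meas[OF this, folded u_def]
  have Ou: "Ord u" using K.Ord u(1) Ord_mem by blast
  have uX0: "u \<in> X0"
    unfolding u_def using good_base_op[OF X0(1)] good_kappa[OF X0(1)] by (simp add: base_ops_def)
  have uY: "u \<in> H.Y"
    unfolding H.Y_def using uX0 u(1) end_ext_subset[OF X(2)] Ord_subset_Vset[OF K.Ord] by blast
  have "countable (elts (H.\<pi> u))"
    unfolding elts_collapse H.Int_Y[OF u(1)] using count[OF uX0 u(1)] by (rule countable_image)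
  then have ne: "H.\<pi> u \<noteq> u" using u(3) unfolding measurable_cardinal_def by auto
  then have \<pi>u: "H.\<pi> u \<in> elts u" "Ord (H.\<pi> u)"
    using collapse_Ord[OF Ou, of H.Y] Ord_subset_iff[of "H.\<pi> u" u] Ou by auto
  have "H.\<pi> u \<in> elts H.M" unfolding H.elts_M using uY by blast
  then obtain \<gamma> where \<gamma>: "is_crit H.M H.j \<gamma>" "\<gamma> = H.\<pi> u \<or> \<gamma> \<in> elts (H.\<pi> u)"
    using H.is_crit_exists[OF _ \<pi>u(2)] H.j_collapse[OF uY] ne by metis
  have \<gamma>u: "\<gamma> \<in> elts u" using \<gamma>(2) \<pi>u(1) Ord_trans[OF Ou] by blast
  have \<gamma>e: "\<gamma> \<in> elts (e i)" if i: "i \<in> elts \<delta>" for i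
  proof -
    have ei: "e i \<in> X" "Ord (e i)" "e i \<notin> X0" using e[OF i] Cardinal_Ord unfolding full_cards_def by blast+
    then have "e i \<notin> elts u" using end_extD[OF X(2) uX0 u(1)] by blast
    then have "u \<in> elts (e i)" using Ord_linear[OF Ou ei(2)] ei(3) uX0 by auto
    then show ?thesis using \<gamma>u Ord_trans[OF ei(2)] by blast
  qed
  have "fixed_cardinals H.M H.j \<gamma> = e ` elts \<delta>"
  proof (intro equalityI subsetI)
    fix x assume "x \<in> fixed_cardinals H.M H.j \<gamma>"
    then have x: "cardinal_in H.M x" "\<gamma> \<in> elts x" "H.j x = x" unfolding fixed_cardinals_def by auto
    then have full: "x \<in> full_cards \<kappa> X" using H.fixed_full_cards by blast
    have "x \<notin> X0"
    proof
      assume "x \<in> X0"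
      then have "countable (elts x)" using full count countable_lepoll unfolding full_cards_def by blast
      moreover have "uncountable (elts x)"
        using H.is_crit_not_countable[OF \<gamma>(1) H.full_cards_fixed(1)[OF full] _ x(2)] x(1)
        unfolding cardinal_in_def by blast
      ultimately show False by simp
    qed
    then show "x \<in> e ` elts \<delta>" using full X(5) by blast
  next
    fix x assume "x \<in> e ` elts \<delta>"
    then obtain i where i: "i \<in> elts \<delta>" "x = e i" by blast
    have full: "x \<in> full_cards \<kappa> X" using e[OF i(1)] i(2) by blast
    note fx = H.full_cards_fixed[OF full]
    have "x \<in> elts H.M" unfolding H.elts_M using fx(1,2) by (metis image_eqI)
    then have "cardinal_in H.M x" using full H.cardinal_in_M_I unfolding full_cards_def by blast
    then show "x \<in> fixed_cardinals H.M H.j \<gamma>" unfolding fixed_cardinals_def using fx(3) \<gamma>e[OF i(1)] i(2) by blast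
  qed
  moreover have "inj_on e (elts \<delta>)"
  proof (rule inj_onI)
    fix i k assume ik: "i \<in> elts \<delta>" "k \<in> elts \<delta>" "e i = e k"
    then show "i = k"
      using Ord_linear[of i k] Ord_mem[OF assms(3)] order[of i k] order[of k i] mem_not_refl[of "e i"] by auto
  qed
  ultimately have "enumerates e \<delta> (fixed_cardinals H.M H.j \<gamma>)"
    unfolding enumerates_def bij_betw_def using order by blast
  then show ?thesis
    using H.Transset_M H.M_subset H.M_eqpoll[OF X(3,4)] H.elementary \<gamma>(1) e by blast
qed

end
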